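(* Let $k,a_1,\dots,a_k,b_1,\dots,b_k$ be natural numbers. For any $0<\varepsilon<1$, any $x>1$ and any natural number $a$, one has $$\mathbb{E}_{2^m<p\leq 2^{m+1}}\left|f_x(ap)-(-1)^k f_x(a)\right| \leq C\varepsilon$$ for all natural numbers $m\leq \log\log x$ outside of an exceptional set $\mathcal{M}$ of natural numbers satisfying $$\sum_{m\in\mathcal{M}}\frac{1}{m}\leq C a\varepsilon^{-3},$$ where $C>0$ is a constant depending only on $k,a_1,\dots,a_k,b_1,\dots,b_k$.
   Context: $\lambda$ is the Liouville function, $\lambda(n)=(-1)^{\Omega(n)}$ with $\Omega(n)$ the number of prime factors of $n$ counted with multiplicity. For a finite nonempty set $A$ and $g:A\to\mathbb{C}$, $\mathbb{E}_{n\in A}g(n)=\frac{\sum_{n\in A}g(n)}{\sum_{n\in A}1}$ and $\mathbb{E}^{\log}_{n\in A}g(n)=\frac{\sum_{n\in A}g(n)/n}{\sum_{n\in A}1/n}$; when the variable is written $p$, the sums run over primes only. For a natural number $a$ and $x\geq 1$, $f_x(a):=\mathbb{E}^{\log}_{n\leq x}\lambda(a_1n+ab_1)\cdots\lambda(a_kn+ab_k)$ (the average over natural numbers $n\leq x$). *)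

theory Defs
  imports "HOL-Analysis.Analysis" "HOL-Computational_Algebra.Primes"
begin

text \<open>\<^term>\<open>prime_factorization n\<close> is a multiset, so its size counts prime factors with
  multiplicity. The value at \<open>0\<close> is irrelevant.\<close>
definition liouville :: "nat \<Rightarrow> int" where
  "liouville n = (- 1) ^ size (prime_factorization n)"

definition avg :: "nat set \<Rightarrow> (nat \<Rightarrow> 'a::real_normed_field) \<Rightarrow> 'a" where
  "avg A g = (\<Sum>n\<in>A. g n) / (\<Sum>n\<in>A. 1)"

text \<open>To be used for finite nonempty sets of positive integers only.\<close>
definition log_avg :: "nat set \<Rightarrow> (nat \<Rightarrow> 'a::real_normed_field) \<Rightarrow> 'a" where
  "log_avg A g = (\<Sum>n\<in>A. g n / of_nat n) / (\<Sum>n\<in>A. 1 / of_nat n)"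

text \<open>The function \<open>f\<^sub>x\<close>; the coefficient tuples are given by the values of \<open>as\<close> and \<open>bs\<close>
  on \<open>{1..k}\<close>.\<close>
definition liouville_corr ::
    "nat \<Rightarrow> (nat \<Rightarrow> nat) \<Rightarrow> (nat \<Rightarrow> nat) \<Rightarrow> real \<Rightarrow> nat \<Rightarrow> real" where
  "liouville_corr k as bs x a =
     log_avg {n. 1 \<le> n \<and> real n \<le> x} (\<lambda>n. \<Prod>i=1..k. of_int (liouville (as i * n + a * bs i)))"

end

theory Submission
  imports Defs "HOL-Number_Theory.Cong" "HOL-Number_Theory.Prime_Powers" "HOL-Real_Asymp.Real_Asymp"
begin

text \<open>
  By complete multiplicativity, \<open>(-1)\<^sup>k f\<^sub>x(a)\<close> is, up to \<open>O(log p / log x)\<close>, the logarithmic average of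
  \<open>p 1\<^bsub>p | n\<^esub>\<close> times the correlation defining \<open>f\<^sub>x(ap)\<close>, so that the average over \<open>p\<close> is a bilinear
  expression in the sign pattern of \<open>\<lambda>\<close> near \<open>n\<close> and the residues of \<open>n\<close> modulo the primes
  \<open>p \<in> (2\<^sup>m, 2\<^bsup>m+1\<^esup>]\<close>. If pattern and residues were independent, it would be small by Hoeffding's
  bound; in general it is bounded by their mutual information (Donsker--Varadhan). Tao's entropy
  decrement bounds this information: conditionally on the residues modulo the primes up to \<open>2\<^sup>m\<close>,
  the entropy of the pattern per unit length drops at each scale by the mutual information found
  there, so the latter is summable over the scales, and Chebyshev's lower bound on the number of
  primes in \<open>(2\<^sup>m, 2\<^bsup>m+1\<^esup>]\<close> turns this into a bound for the sum of \<open>1 / m\<close> over the bad scales.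

  To have exact instead of approximate shift invariance, the logarithmic average is replaced by a
  mixture of uniform averages over blocks of a length \<open>L\<close> divisible by all primes involved, and
  each block is made cyclic. As \<open>log L\<close> is of order \<open>2\<^bsup>log log x\<^esup> = (log x)\<^bsup>log 2\<^esup>\<close>, this costs only
  \<open>O((2/e)\<^sup>m)\<close>.
\<close>

section \<open>Primes in dyadic intervals\<close>

lemma sum_multiples:
  fixes F :: "nat \<Rightarrow> real"
  assumes "p > 0"
  shows "(\<Sum>n=1..N. if p dvd n then F n else 0) = (\<Sum>j=1..N div p. F (p * j))"
proof -
  have "{n\<in>{1..N}. p dvd n} = (\<lambda>j. p * j) ` {1..N div p}"
  proof (intro equalityI subsetI)
    fix m assume m: "m \<in> {n\<in>{1..N}. p dvd n}"
    then obtain j where j: "m = p * j" by auto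
    then have "j \<ge> 1" using m by (cases j) auto
    moreover have "j \<le> N div p" using j m assms by (simp add: less_eq_div_iff_mult_less_eq mult.commute)
    ultimately show "m \<in> (\<lambda>j. p * j) ` {1..N div p}" using j by auto
  next
    fix m assume "m \<in> (\<lambda>j. p * j) ` {1..N div p}"
    then obtain j where j: "m = p * j" "1 \<le> j" "j \<le> N div p" by (elim imageE) auto
    then have "j * p \<le> N" using assms by (simp add: less_eq_div_iff_mult_less_eq)
    then show "m \<in> {n\<in>{1..N}. p dvd n}" using j assms by (simp add: mult.commute Suc_leI)
  qed
  moreover have "inj_on (\<lambda>j. p * j) {1..N div p}" using assms by (auto simp: inj_on_def)
  ultimately show ?thesis
    by (simp add: sum.inter_filter[symmetric] sum.reindex)
qed

lemma prod_primes_dvd: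
  fixes A :: "nat set"
  assumes "finite A" "\<And>p. p \<in> A \<Longrightarrow> prime p" "\<And>p. p \<in> A \<Longrightarrow> p dvd n"
  shows "\<Prod>A dvd n"
  using assms
proof (induction A rule: finite_induct)
  case (insert p A)
  have "coprime p (\<Prod>A)"
    by (rule prod_coprime_right) (use insert in \<open>auto intro!: primes_coprime\<close>)
  then show ?case using insert by (auto intro!: divides_mult)
qed simp

section \<open>Chebyshev's upper bound for the primorial\<close>

lemma prime_dvd_binomial:
  fixes p :: nat
  assumes "prime p" "k < p" "n - k < p" "p \<le> n"
  shows "p dvd (n choose k)"
proof -
  have "k \<le> n" using assms by simp
  have "p dvd fact n" using assms by (simp add: prime_dvd_fact_iff)
  also have "fact n = fact k * fact (n - k) * (n choose k)"
    using binomial_fact_lemma[OF \<open>k \<le> n\<close>] by simp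
  finally show ?thesis using assms by (simp add: prime_dvd_mult_iff prime_dvd_fact_iff)
qed

text \<open>Erdos's induction: for odd \<open>n = 2 * k + 1\<close> the primes in
  \<open>(k + 1, n]\<close> all divide \<open>n choose k\<close>, which is at most
  \<open>4 ^ k\<close> because it occurs twice in its row of Pascal's triangle; the primes up to
  \<open>k + 1\<close> are left to the induction hypothesis. An even \<open>n > 2\<close> is not
  prime and adds nothing.\<close>

lemma primorial_le: "\<Prod>{p::nat. prime p \<and> p \<le> n} \<le> 4 ^ n"
proof (induction n rule: less_induct)
  case (less n)
  let ?P = "\<lambda>n. {p::nat. prime p \<and> p \<le> n}"
  consider "n \<le> 2" | "n > 2" "even n" | "n > 2" "odd n" by linarith
  then show ?case
  proof cases
    case 1
    then have "?P n = (if n = 2 then {2} else {})"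
      by (auto dest: prime_ge_2_nat)
    then show ?thesis by simp
  next
    case 2
    have "\<not> prime n" using 2 prime_odd_nat by blast
    have "?P n = ?P (n - 1)"
    proof (intro Collect_cong conj_cong refl)
      fix p :: nat assume "prime p"
      then have "p \<noteq> n" using \<open>\<not> prime n\<close> by blast
      then show "p \<le> n \<longleftrightarrow> p \<le> n - 1" using 2 by linarith
    qed
    moreover have "\<Prod>(?P (n - 1)) \<le> 4 ^ (n - 1)" using less.IH[of "n - 1"] 2 by simp
    moreover have "(4::nat) ^ (n - 1) \<le> 4 ^ n" by (rule power_increasing) auto
    ultimately show ?thesis by (metis le_trans)
  next
    case 3
    then obtain k where n: "n = 2 * k + 1" by (elim oddE)
    have k: "k \<ge> 1" using 3 n by simp
    let ?Q = "{p::nat. prime p \<and> k + 1 < p \<and> p \<le> n}"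
    have "?P n = ?P (k + 1) \<union> ?Q" using n k by auto
    then have "\<Prod>(?P n) = \<Prod>(?P (k + 1)) * \<Prod>?Q"
      by (simp only:) (rule prod.union_disjoint, auto)
    also have "\<dots> \<le> 4 ^ (k + 1) * (n choose k)"
    proof (rule mult_le_mono)
      show "\<Prod>(?P (k + 1)) \<le> 4 ^ (k + 1)" using less.IH[of "k + 1"] n k by simp
      have "\<Prod>?Q dvd (n choose k)"
        by (rule prod_primes_dvd) (use n in \<open>auto intro!: prime_dvd_binomial\<close>)
      then show "\<Prod>?Q \<le> (n choose k)"
        by (rule dvd_imp_le) (use n in auto)
    qed
    also have "(n choose k) \<le> 4 ^ k"
    proof -
      have "(n choose k) = (n choose (k + 1))"
        by (subst binomial_symmetric) (use n in auto)
      then have "2 * (n choose k) = (\<Sum>i\<in>{k, k + 1}. n choose i)" by simp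
      also have "\<dots> \<le> (\<Sum>i\<le>n. n choose i)" by (rule sum_mono2) (use n k in auto)
      also have "\<dots> = 2 ^ n" by (rule choose_row_sum)
      also have "\<dots> = 2 * 4 ^ k" by (simp add: n power_mult)
      finally show ?thesis by simp
    qed
    then have "4 ^ (k + 1) * (n choose k) \<le> 4 ^ (k + 1) * 4 ^ k" by simp
    also have "\<dots> = 4 ^ n" by (simp add: n mult_2 power_add)
    finally show ?thesis .
  qed
qed

lemma sum_ln_primes_le: "(\<Sum>p | prime p \<and> p \<le> n. ln (real p)) \<le> real n * ln 4"
proof -
  have fin: "finite {p::nat. prime p \<and> p \<le> n}" by simp
  have "(\<Sum>p | prime p \<and> p \<le> n. ln (real p)) = ln (\<Prod>p | prime p \<and> p \<le> n. real p)"
    by (rule ln_prod[symmetric]) (auto simp: prime_gt_0_nat)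
  also have "(\<Prod>p | prime p \<and> p \<le> n. real p) = real (\<Prod>{p::nat. prime p \<and> p \<le> n})"
    by simp
  also have "ln \<dots> \<le> ln (4 ^ n)"
  proof -
    have "\<Prod>{p::nat. prime p \<and> p \<le> n} > 0" by (rule prod_pos) (auto simp: prime_gt_0_nat)
    moreover have "real (\<Prod>{p::nat. prime p \<and> p \<le> n}) \<le> 4 ^ n"
      using primorial_le[of n] by (metis of_nat_le_iff of_nat_numeral of_nat_power)
    ultimately show ?thesis by (intro ln_mono) (simp_all only: of_nat_0_less_iff)
  qed
  also have "\<dots> = real n * ln 4" by (simp add: ln_realpow)
  finally show ?thesis .
qed

section \<open>Chebyshev's lower bound for the primes in a dyadic interval\<close>

text \<open>Legendre's formula, from \<open>ln m\<close> being the sum of the von Mangoldt function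
  over the divisors of \<open>m\<close>. The free cutoff \<open>N\<close> lets the formulas for
  \<open>n\<close> and \<open>2 * n\<close> be subtracted over one common range.\<close>

lemma ln_fact_mangoldt:
  assumes "n \<le> N"
  shows "ln (fact n) = (\<Sum>d\<in>{1..N}. mangoldt d * real (n div d))"
proof -
  have "ln (fact n :: real) = (\<Sum>m\<in>{1..n}. ln (real m))"
    by (simp only: fact_prod of_nat_prod of_nat_fact) (rule ln_prod, auto)
  also have "\<dots> = (\<Sum>m\<in>{1..n}. \<Sum>d\<in>{1..N}. if d dvd m then mangoldt d else 0)"
  proof (rule sum.cong[OF refl])
    fix m assume m: "m \<in> {1..n}"
    have "ln (real m) = (\<Sum>d | d dvd m. mangoldt d)"
      using mangoldt_sum[of m, where 'a = real] m by simp
    also have "\<dots> = (\<Sum>d\<in>{d\<in>{1..N}. d dvd m}. mangoldt d)"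
    proof (rule sum.cong)
      have "1 \<le> d \<and> d \<le> N" if "d dvd m" for d
        using that m assms dvd_imp_le[OF that] by (cases "d = 0") auto
      then show "{d. d dvd m} = {d\<in>{1..N}. d dvd m}" by auto
    qed simp
    also have "\<dots> = (\<Sum>d\<in>{1..N}. if d dvd m then mangoldt d else 0)"
      by (rule sum.inter_filter) auto
    finally show "ln (real m) = \<dots>" .
  qed
  also have "\<dots> = (\<Sum>d\<in>{1..N}. \<Sum>m\<in>{1..n}. if d dvd m then mangoldt d else 0)"
    by (rule sum.swap)
  also have "\<dots> = (\<Sum>d\<in>{1..N}. mangoldt d * real (n div d))"
  proof (rule sum.cong[OF refl])
    fix d assume "d \<in> {1..N}"
    then show "(\<Sum>m\<in>{1..n}. if d dvd m then mangoldt d else 0) = mangoldt d * real (n div d)"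
      using sum_multiples[of d "\<lambda>_. mangoldt d" n] by simp
  qed
  finally show ?thesis .
qed

text \<open>By Legendre's formula \<open>mangoldt d\<close> occurs with the coefficient
  \<open>2 * n div d - 2 * (n div d)\<close>, which is at most 1 and vanishes for
  \<open>2 * n / 3 < d \<le> n\<close>, where the two quotients are 2 and 1.\<close>

lemma ln_central_binomial_le:
  "ln (real ((2 * n) choose n)) \<le> (\<Sum>p | prime p \<and> p \<le> 2 * n div 3. ln (real p)) +
     (\<Sum>p | prime p \<and> n < p \<and> p \<le> 2 * n. ln (real p)) + (\<Sum>d | d \<in> {1..2 * n} \<and> \<not> prime d. mangoldt d)"
proof -
  have "fact (2 * n) = fact n * fact n * real ((2 * n) choose n)"
    using arg_cong[OF binomial_fact_lemma[of n "2 * n"], of real] by simp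
  then have "ln (fact (2 * n) :: real) = ln (fact n) + ln (fact n) + ln (real ((2 * n) choose n))"
    by (simp add: ln_mult)
  then have "ln (real ((2 * n) choose n)) = ln (fact (2 * n)) - 2 * ln (fact n)"
    by simp
  also have "\<dots> = (\<Sum>d\<in>{1..2 * n}. mangoldt d * (real (2 * n div d) - 2 * real (n div d)))"
    by (simp add: ln_fact_mangoldt[of _ "2 * n"] sum_distrib_left sum_subtractf algebra_simps)
  also have "\<dots> \<le> (\<Sum>d\<in>{1..2 * n}. (if prime d \<and> d \<le> 2 * n div 3 then ln (real d) else 0) +
     (if prime d \<and> n < d then ln (real d) else 0) + (if \<not> prime d then mangoldt d else 0))"
  proof (rule sum_mono)
    fix d assume d: "d \<in> {1..2 * n}"
    have "2 * n div d \<le> 2 * (n div d) + 1"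
    proof -
      have "n < (n div d + 1) * d" using d by (simp add: dividend_less_times_div algebra_simps)
      then have "2 * n < (2 * (n div d) + 2) * d" by (simp add: algebra_simps)
      then have "2 * n div d < 2 * (n div d) + 2" using d by (simp add: less_mult_imp_div_less)
      then show ?thesis by simp
    qed
    then have le1: "real (2 * n div d) - 2 * real (n div d) \<le> 1" by linarith
    have *: "mangoldt d * (real (2 * n div d) - 2 * real (n div d)) \<le> mangoldt d"
      using mult_left_mono[OF le1 mangoldt_nonneg[of d]] by simp
    have ln: "ln (real d) \<ge> 0" using d by simp
    show "mangoldt d * (real (2 * n div d) - 2 * real (n div d)) \<le>
      (if prime d \<and> d \<le> 2 * n div 3 then ln (real d) else 0) +
      (if prime d \<and> n < d then ln (real d) else 0) + (if \<not> prime d then mangoldt d else 0)"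
    proof (cases "prime d \<and> \<not> d \<le> 2 * n div 3 \<and> \<not> n < d")
      case True
      then have "2 * n < 3 * d" "d \<le> n" by auto
      then have "2 * n div d = 2" "n div d = 1"
        by (auto intro!: div_nat_eqI)
      then show ?thesis using ln True by simp
    next
      case False
      then show ?thesis using * ln by (auto simp: mangoldt_prime)
    qed
  qed
  also have "\<dots> = (\<Sum>d\<in>{d\<in>{1..2 * n}. prime d \<and> d \<le> 2 * n div 3}. ln (real d)) +
     (\<Sum>d\<in>{d\<in>{1..2 * n}. prime d \<and> n < d}. ln (real d)) + (\<Sum>d\<in>{d\<in>{1..2 * n}. \<not> prime d}. mangoldt d)"
    by (simp only: sum.distrib sum.inter_filter finite_atLeastAtMost)
  also have "{d\<in>{1..2 * n}. prime d \<and> d \<le> 2 * n div 3} = {p. prime p \<and> p \<le> 2 * n div 3}"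
    by (auto simp: prime_gt_0_nat Suc_leI)
  also have "{d\<in>{1..2 * n}. prime d \<and> n < d} = {p. prime p \<and> n < p \<and> p \<le> 2 * n}"
    by (auto simp: prime_gt_0_nat Suc_leI)
  finally show ?thesis by simp
qed

text \<open>Only prime powers \<open>p ^ k\<close> with \<open>k \<ge> 2\<close> contribute. They
  satisfy \<open>k \<le> m\<close> and, with the exponent \<open>m / 2\<close> rounded up,
  \<open>p \<le> 2 ^ ((m + 1) div 2)\<close>; this bounds their number, and each contributes at most
  \<open>m * ln 2\<close>.\<close>

lemma sum_mangoldt_not_prime_le:
  "(\<Sum>d | d \<in> {1..2 ^ m} \<and> \<not> prime d. mangoldt d) \<le> real ((2 ^ ((m + 1) div 2) + 1) * (m + 1)) * (real m * ln 2)"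
proof -
  let ?s = "(m + 1) div 2"
  let ?D = "{d::nat. d \<in> {1..2 ^ m} \<and> \<not> prime d \<and> primepow d}"
  have "(\<Sum>d | d \<in> {1..2 ^ m} \<and> \<not> prime d. mangoldt d) = (\<Sum>d\<in>?D. mangoldt d :: real)"
    by (rule sum.mono_neutral_right) (auto simp: mangoldt_def)
  also have "\<dots> \<le> real (card ?D) * (real m * ln 2)"
  proof (rule sum_bounded_above)
    fix d assume d: "d \<in> ?D"
    then have "mangoldt d \<le> ln (real d)" by (intro mangoldt_le) auto
    also have "\<dots> \<le> ln (2 ^ m)" using d by (intro ln_mono) (auto simp flip: of_nat_le_iff)
    finally show "mangoldt d \<le> real m * ln 2" by (simp add: ln_realpow)
  qed
  also have "card ?D \<le> card ((\<lambda>(p, k). p ^ k) ` ({..2 ^ ?s} \<times> {..m}) :: nat set)"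
  proof (rule card_mono)
    show "?D \<subseteq> (\<lambda>(p, k). p ^ k) ` ({..2 ^ ?s} \<times> {..m})"
    proof
      fix d assume d: "d \<in> ?D"
      then obtain p k where pk: "prime p" "k > 0" "d = p ^ k" by (auto simp: primepow_def)
      have "k \<noteq> 1" using d pk by auto
      then have k2: "k \<ge> 2" using pk by simp
      have p2: "p \<ge> 2" using pk prime_ge_2_nat by simp
      have le: "p ^ k \<le> 2 ^ m" using d pk by simp
      have "(2::nat) ^ k \<le> p ^ k" using p2 by (rule power_mono) simp
      then have "(2::nat) ^ k \<le> 2 ^ m" using le by (rule order.trans)
      then have "k \<le> m" using power_le_imp_le_exp[of "2::nat" k m] by simp
      have "p ^ 2 \<le> p ^ k" using k2 p2 by (intro power_increasing) auto
      also have "\<dots> \<le> 2 ^ (2 * ?s)" using le by (rule order.trans) (intro power_increasing, auto)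
      also have "\<dots> = (2 ^ ?s) ^ 2" by (metis power_mult mult.commute)
      finally have "p \<le> 2 ^ ?s" by (rule power2_le_imp_le) simp
      then show "d \<in> (\<lambda>(p, k). p ^ k) ` ({..2 ^ ?s} \<times> {..m})"
        using \<open>k \<le> m\<close> pk by (auto intro!: image_eqI[of _ _ "(p, k)"])
    qed
  qed auto
  also have "\<dots> \<le> card ({..2 ^ ?s} \<times> {..m} :: (nat \<times> nat) set)" by (rule card_image_le) auto
  also have "\<dots> = (2 ^ ?s + 1) * (m + 1)" by simp
  finally show ?thesis by (simp add: mult_right_mono)
qed

text \<open>With \<open>n = 2 ^ m\<close>, the central binomial coefficient has logarithm at least
  \<open>n * ln 4\<close> up to a term of order \<open>m\<close>. The primes up to
  \<open>2 * n / 3\<close> account for at most two thirds of this and the proper prime powers for a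
  lower order. About \<open>n * ln 4 / 3\<close> is left for the primes in
  \<open>(n, 2 * n]\<close>, each of which contributes at most
  \<open>(m + 1) * ln 2\<close>.\<close>

lemma card_dyadic_primes_ge:
  "\<exists>m0. \<forall>m\<ge>m0. 2 ^ m / (4 * real m) \<le> real (card {p::nat. prime p \<and> 2 ^ m < p \<and> p \<le> 2 ^ (m + 1)})"
proof -
  \<comment> \<open>The right side divided by \<open>m + 1\<close> is asymptotic to
    \<open>2 / 3 * 2 ^ m / m\<close>, which leaves room for the constant
    \<open>1 / 4\<close>.\<close>
  have "eventually (\<lambda>m. 2 ^ m / (4 * real m) * (real m + 1) \<le> 2 ^ m * 2 / 3 - (real m + 1) -
       (2 * 2 powr (real m / 2) + 1) * (real m + 2) * (real m + 1)) at_top"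
    by real_asymp
  then obtain m0 where m0: "\<And>m. m \<ge> m0 \<Longrightarrow> 2 ^ m / (4 * real m) * (real m + 1) \<le> 2 ^ m * 2 / 3 - (real m + 1) -
       (2 * 2 powr (real m / 2) + 1) * (real m + 2) * (real m + 1)"
    unfolding eventually_at_top_linorder by auto
  have ln4: "ln 4 = 2 * ln (2::real)"
    using ln_realpow[of 2 2] by simp
  show ?thesis
  proof (intro exI allI impI)
    fix m assume "m \<ge> m0"
    define n where "n = (2::nat) ^ m"
    define N where "N = card {p::nat. prime p \<and> 2 ^ m < p \<and> p \<le> 2 ^ (m + 1)}"
    have n2: "2 * n = 2 ^ (m + 1)" by (simp add: n_def)
    have ln2n: "ln (2 * real n) = real (m + 1) * ln 2"
      using n2 by (metis ln_realpow of_nat_mult of_nat_numeral of_nat_power zero_less_numeral)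
    have "real n * ln 4 - real (m + 1) * ln 2 = ln (4 ^ n / (2 * real n))"
      by (subst ln2n[symmetric], subst ln_div) (auto simp: n_def ln_realpow)
    also have "\<dots> \<le> ln (real ((2 * n) choose n))"
      by (intro ln_mono central_binomial_lower_bound) (auto simp: n_def)
    also have "\<dots> \<le> (\<Sum>p | prime p \<and> p \<le> 2 * n div 3. ln (real p)) +
     (\<Sum>p | prime p \<and> n < p \<and> p \<le> 2 * n. ln (real p)) + (\<Sum>d | d \<in> {1..2 * n} \<and> \<not> prime d. mangoldt d)"
      by (rule ln_central_binomial_le)
    also have "\<dots> \<le> 2 * real n / 3 * ln 4 + real N * (real (m + 1) * ln 2)
        + (2 * 2 powr (real m / 2) + 1) * (real m + 2) * (real (m + 1) * ln 2)"
    proof (intro add_mono)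
      have "(\<Sum>p | prime p \<and> p \<le> 2 * n div 3. ln (real p)) \<le> real (2 * n div 3) * ln 4"
        by (rule sum_ln_primes_le)
      also have "\<dots> \<le> 2 * real n / 3 * ln 4"
        by (intro mult_right_mono) (linarith, simp)
      finally show "(\<Sum>p | prime p \<and> p \<le> 2 * n div 3. ln (real p)) \<le> 2 * real n / 3 * ln 4" .
      have "(\<Sum>p | prime p \<and> n < p \<and> p \<le> 2 * n. ln (real p)) \<le>
          real (card {p. prime p \<and> n < p \<and> p \<le> 2 * n}) * (real (m + 1) * ln 2)"
      proof (rule sum_bounded_above)
        fix p assume p: "p \<in> {p. prime p \<and> n < p \<and> p \<le> 2 * n}"
        then have "ln (real p) \<le> ln (2 * real n)" by (intro ln_mono) auto
        then show "ln (real p) \<le> real (m + 1) * ln 2" by (simp only: ln2n)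
      qed
      then show "(\<Sum>p | prime p \<and> n < p \<and> p \<le> 2 * n. ln (real p)) \<le> real N * (real (m + 1) * ln 2)"
        by (simp add: N_def n_def)
      have "(\<Sum>d | d \<in> {1..2 * n} \<and> \<not> prime d. mangoldt d) \<le>
          real ((2 ^ ((m + 1 + 1) div 2) + 1) * (m + 1 + 1)) * (real (m + 1) * ln 2)"
        unfolding n2 by (rule sum_mangoldt_not_prime_le)
      also have "\<dots> \<le> (2 * 2 powr (real m / 2) + 1) * (real m + 2) * (real (m + 1) * ln 2)"
      proof -
        have "(2::real) ^ ((m + 1 + 1) div 2) = 2 powr real ((m + 1 + 1) div 2)" by (rule powr_realpow[symmetric]) simp
        also have "\<dots> \<le> 2 powr (1 + real m / 2)" by (intro powr_mono) linarith+
        also have "\<dots> = 2 * 2 powr (real m / 2)" by (simp add: powr_add)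
        finally have "((2::real) ^ ((m + 1 + 1) div 2) + 1) * (real m + 2) * (real (m + 1) * ln 2) \<le>
            (2 * 2 powr (real m / 2) + 1) * (real m + 2) * (real (m + 1) * ln 2)"
          by (intro mult_right_mono add_right_mono) simp_all
        then show ?thesis by (simp only: of_nat_mult of_nat_add of_nat_power of_nat_numeral of_nat_1 add.assoc one_add_one)
      qed
      finally show "(\<Sum>d | d \<in> {1..2 * n} \<and> \<not> prime d. mangoldt d) \<le> \<dots>" .
    qed
    finally have "(2 ^ m * 2 / 3 - (real m + 1) - (2 * 2 powr (real m / 2) + 1) * (real m + 2) * (real m + 1)) * ln 2
        \<le> (real N * (real m + 1)) * ln 2"
      by (simp add: n_def ln4 algebra_simps)
    then have "2 ^ m * 2 / 3 - (real m + 1) - (2 * 2 powr (real m / 2) + 1) * (real m + 2) * (real m + 1)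
        \<le> real N * (real m + 1)"
      by (rule mult_right_le_imp_le) simp
    with m0[OF \<open>m \<ge> m0\<close>] have "2 ^ m / (4 * real m) * (real m + 1) \<le> real N * (real m + 1)"
      by linarith
    then have "2 ^ m / (4 * real m) \<le> real N"
      by (rule mult_right_le_imp_le) simp
    then show "2 ^ m / (4 * real m) \<le> real (card {p::nat. prime p \<and> 2 ^ m < p \<and> p \<le> 2 ^ (m + 1)})"
      by (simp add: N_def)
  qed
qed

section \<open>Entropy on a finite uniform space\<close>

definition fiber_card :: "'a set \<Rightarrow> ('a \<Rightarrow> 'b) \<Rightarrow> 'a \<Rightarrow> nat" where
  "fiber_card A U x = card {y\<in>A. U y = U x}"

text \<open>The entropy of \<open>U\<close> under the uniform distribution on \<open>A\<close> is \<open>ln |A| - log_fiber A U / |A|\<close>.\<close>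
definition log_fiber :: "'a set \<Rightarrow> ('a \<Rightarrow> 'b) \<Rightarrow> real" where
  "log_fiber A U = (\<Sum>x\<in>A. ln (real (fiber_card A U x)))"

lemma fiber_card_pos: "finite A \<Longrightarrow> x \<in> A \<Longrightarrow> fiber_card A U x > 0"
  by (auto simp: fiber_card_def card_gt_0_iff)

lemma log_fiber_cong:
  assumes "\<And>x y. x \<in> A \<Longrightarrow> y \<in> A \<Longrightarrow> U x = U y \<longleftrightarrow> V x = V y"
  shows "log_fiber A U = log_fiber A V"
proof -
  have "{y\<in>A. U y = U x} = {y\<in>A. V y = V x}" if "x \<in> A" for x using assms that by blast
  then show ?thesis by (simp add: log_fiber_def fiber_card_def)
qed

lemma log_fiber_mono:
  assumes "finite A" "\<And>x y. x \<in> A \<Longrightarrow> y \<in> A \<Longrightarrow> U x = U y \<Longrightarrow> V x = V y"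
  shows "log_fiber A U \<le> log_fiber A V"
  unfolding log_fiber_def
proof (rule sum_mono)
  fix x assume "x \<in> A"
  then have "fiber_card A U x \<le> fiber_card A V x"
    unfolding fiber_card_def by (intro card_mono Collect_mono) (simp add: assms(1), blast dest: assms(2))
  then show "ln (real (fiber_card A U x)) \<le> ln (real (fiber_card A V x))"
    using fiber_card_pos[OF assms(1) \<open>x \<in> A\<close>, of U] by (intro ln_mono) auto
qed

lemma log_fiber_reindex:
  assumes "bij_betw s A A"
  shows "log_fiber A (\<lambda>x. U (s x)) = log_fiber A U"
proof -
  have "fiber_card A (\<lambda>x. U (s x)) x = fiber_card A U (s x)" if "x \<in> A" for x
  proof -
    have "{y\<in>A. U y = U (s x)} = s ` {y\<in>A. U (s y) = U (s x)}"
      using assms by (auto simp: bij_betw_def)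
    moreover have "inj_on s {y\<in>A. U (s y) = U (s x)}"
      using assms by (auto simp: bij_betw_def inj_on_def)
    ultimately show ?thesis by (simp add: fiber_card_def card_image)
  qed
  then have "log_fiber A (\<lambda>x. U (s x)) = (\<Sum>x\<in>A. ln (real (fiber_card A U (s x))))"
    by (simp add: log_fiber_def)
  also have "\<dots> = log_fiber A U"
    unfolding log_fiber_def by (rule sum.reindex_bij_betw[OF assms])
  finally show ?thesis .
qed

lemma sum_div_fiber_card:
  fixes h :: "'b \<Rightarrow> real"
  assumes "finite A"
  shows "(\<Sum>x\<in>A. h (V x) / real (fiber_card A V x)) = (\<Sum>v\<in>V ` A. h v)"
proof -
  have "(\<Sum>x\<in>A. h (V x) / real (fiber_card A V x))
      = (\<Sum>v\<in>V ` A. \<Sum>x\<in>{x\<in>A. V x = v}. h (V x) / real (fiber_card A V x))"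
    by (rule sum.image_gen[OF assms])
  also have "\<dots> = (\<Sum>v\<in>V ` A. h v)"
  proof (rule sum.cong[OF refl])
    fix v assume "v \<in> V ` A"
    then have "{x\<in>A. V x = v} \<noteq> {}" by auto
    then have "card {x\<in>A. V x = v} > 0" using assms by (simp add: card_gt_0_iff)
    moreover have "(\<Sum>x\<in>{x\<in>A. V x = v}. h (V x) / real (fiber_card A V x))
        = (\<Sum>x\<in>{x\<in>A. V x = v}. h v / real (card {x\<in>A. V x = v}))"
      by (rule sum.cong) (auto simp: fiber_card_def)
    ultimately show "(\<Sum>x\<in>{x\<in>A. V x = v}. h (V x) / real (fiber_card A V x)) = h v"
      by simp
  qed
  finally show ?thesis .
qed

text \<open>Gibbs' inequality: \<open>w x\<close> is a subprobability competing with the conditional law of \<open>V\<close> given \<open>U\<close>.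
  Submodularity, the bound by the size of the alphabet, and the Donsker--Varadhan inequality are
  all obtained by choosing \<open>w\<close>.\<close>
lemma log_fiber_gibbs:
  fixes w :: "'a \<Rightarrow> 'v \<Rightarrow> real"
  assumes fin: "finite A"
    and pos: "\<And>x. x \<in> A \<Longrightarrow> w x (V x) > 0"
    and inv: "\<And>x y. x \<in> A \<Longrightarrow> y \<in> A \<Longrightarrow> U x = U y \<Longrightarrow> w x = w y"
    and le1: "\<And>x. x \<in> A \<Longrightarrow> (\<Sum>v\<in>V ` {y\<in>A. U y = U x}. w x v) \<le> 1"
  shows "(\<Sum>x\<in>A. ln (w x (V x))) \<le> log_fiber A (\<lambda>x. (U x, V x)) - log_fiber A U"
proof -
  let ?cU = "\<lambda>x. real (fiber_card A U x)" and ?cUV = "\<lambda>x. real (fiber_card A (\<lambda>x. (U x, V x)) x)"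
  have cpos: "?cU x > 0" "?cUV x > 0" if "x \<in> A" for x
    using fiber_card_pos[OF fin that] by auto
  have "(\<Sum>x\<in>A. ln (w x (V x))) - (log_fiber A (\<lambda>x. (U x, V x)) - log_fiber A U)
      = (\<Sum>x\<in>A. ln (w x (V x) * ?cU x / ?cUV x))"
    unfolding log_fiber_def sum_subtractf[symmetric]
  proof (rule sum.cong[OF refl])
    fix x assume "x \<in> A"
    then have "w x (V x) \<noteq> 0" "?cU x \<noteq> 0" "?cUV x \<noteq> 0"
      using cpos[of x] pos[of x] by simp_all
    then show "ln (w x (V x)) - (ln (?cUV x) - ln (?cU x)) = ln (w x (V x) * ?cU x / ?cUV x)"
      by (subst ln_div) (simp_all add: ln_mult)
  qed
  \<comment> \<open>It now suffices that the likelihood ratios sum to at most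
    \<open>card A\<close>.\<close>
  also have "\<dots> \<le> (\<Sum>x\<in>A. w x (V x) * ?cU x / ?cUV x - 1)"
    using cpos pos by (intro sum_mono ln_le_minus_one) simp
  also have "\<dots> = (\<Sum>x\<in>A. w x (V x) * ?cU x / ?cUV x) - real (card A)"
    by (simp add: sum_subtractf)
  \<comment> \<open>The factor \<open>?cU x\<close> is expanded as a count of the points
    \<open>y\<close> in the fiber of \<open>x\<close>. After the exchange of sums, the inner sum
    over the fiber of \<open>y\<close> is the mass of one competing law, at most 1.\<close>
  also have "(\<Sum>x\<in>A. w x (V x) * ?cU x / ?cUV x)
      = (\<Sum>x\<in>A. \<Sum>y\<in>{y\<in>A. U y = U x}. w x (V x) / ?cUV x)"
    by (rule sum.cong) (simp_all add: fiber_card_def[of A U])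
  also have "\<dots> = (\<Sum>y\<in>A. \<Sum>x\<in>{x\<in>A. U y = U x}. w x (V x) / ?cUV x)"
    by (rule sum.swap_restrict[OF fin fin])
  also have "\<dots> \<le> (\<Sum>y\<in>A. 1)"
  proof (rule sum_mono)
    fix y assume y: "y \<in> A"
    let ?B = "{x\<in>A. U x = U y}"
    have "(\<Sum>x\<in>{x\<in>A. U y = U x}. w x (V x) / ?cUV x) = (\<Sum>x\<in>?B. w y (V x) / real (fiber_card ?B V x))"
    proof (rule sum.cong)
      fix x assume x: "x \<in> ?B"
      then have "w x = w y" using inv y by blast
      moreover have "{z\<in>A. (U z, V z) = (U x, V x)} = {z\<in>?B. V z = V x}" using x by auto
      ultimately show "w x (V x) / ?cUV x = w y (V x) / real (fiber_card ?B V x)"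
        by (simp add: fiber_card_def)
    qed auto
    also have "\<dots> = (\<Sum>v\<in>V ` ?B. w y v)" by (rule sum_div_fiber_card) (use fin in simp)
    also have "\<dots> \<le> 1" by (rule le1[OF y])
    finally show "(\<Sum>x\<in>{x\<in>A. U y = U x}. w x (V x) / ?cUV x) \<le> 1" .
  qed
  finally show ?thesis by simp
qed

text \<open>Strong subadditivity: conditioning on \<open>U\<close> in addition to \<open>W\<close>
  does not increase the entropy of \<open>V\<close>. The competing law in Gibbs' inequality is that
  of \<open>V\<close> given \<open>W\<close> alone.\<close>

lemma log_fiber_submodular:
  assumes "finite A"
  shows "log_fiber A (\<lambda>x. (W x, V x)) + log_fiber A (\<lambda>x. (W x, U x))
    \<le> log_fiber A (\<lambda>x. ((W x, U x), V x)) + log_fiber A W"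
proof -
  define w where "w x v = real (card {y\<in>A. W y = W x \<and> V y = v}) / real (fiber_card A W x)" for x v
  have w: "w x (V x) = real (fiber_card A (\<lambda>x. (W x, V x)) x) / real (fiber_card A W x)" for x
    by (simp add: w_def fiber_card_def)
  have "(\<Sum>x\<in>A. ln (w x (V x))) \<le> log_fiber A (\<lambda>x. ((W x, U x), V x)) - log_fiber A (\<lambda>x. (W x, U x))"
  proof (rule log_fiber_gibbs[OF assms])
    show "w x (V x) > 0" if "x \<in> A" for x
      unfolding w by (intro divide_pos_pos) (simp_all only: of_nat_0_less_iff fiber_card_pos[OF assms that])
    show "w x = w y" if "(W x, U x) = (W y, U y)" for x y
      using that by (simp add: w_def fiber_card_def fun_eq_iff)
    show "(\<Sum>v\<in>V ` {y \<in> A. (W y, U y) = (W x, U x)}. w x v) \<le> 1" if "x \<in> A" for x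
    proof -
      let ?B = "{y\<in>A. W y = W x}"
      have "(\<Sum>v\<in>V ` {y \<in> A. (W y, U y) = (W x, U x)}. w x v) \<le> (\<Sum>v\<in>V ` ?B. w x v)"
        by (rule sum_mono2) (use assms in \<open>auto simp: w_def\<close>)
      also have "\<dots> = (\<Sum>v\<in>V ` ?B. \<Sum>y\<in>{y\<in>?B. V y = v}. 1) / real (card ?B)"
        by (simp add: w_def fiber_card_def sum_divide_distrib conj_assoc)
      also have "(\<Sum>v\<in>V ` ?B. \<Sum>y\<in>{y\<in>?B. V y = v}. 1) = (\<Sum>y\<in>?B. 1::real)"
        by (rule sum.image_gen[symmetric]) (use assms in simp)
      finally show ?thesis by (simp split: if_splits)
    qed
  qed
  moreover have "(\<Sum>x\<in>A. ln (w x (V x))) = log_fiber A (\<lambda>x. (W x, V x)) - log_fiber A W"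
    unfolding w log_fiber_def sum_subtractf[symmetric]
  proof (rule sum.cong[OF refl])
    fix x assume "x \<in> A"
    have "real (fiber_card A (\<lambda>x. (W x, V x)) x) > 0" "real (fiber_card A W x) > 0"
      using fiber_card_pos[OF assms \<open>x \<in> A\<close>, of W]
        fiber_card_pos[OF assms \<open>x \<in> A\<close>, of "\<lambda>x. (W x, V x)"] by simp_all
    then show "ln (real (fiber_card A (\<lambda>x. (W x, V x)) x) / real (fiber_card A W x)) =
        ln (real (fiber_card A (\<lambda>x. (W x, V x)) x)) - ln (real (fiber_card A W x))"
      by (simp add: ln_div)
  qed
  ultimately show ?thesis by simp
qed

text \<open>The uniform law on the alphabet \<open>S\<close> is the competing law, so the
  conditional entropy is at most \<open>ln (card S)\<close>.\<close>

lemma log_fiber_card_le: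
  assumes "finite A" "finite S" "V ` A \<subseteq> S" "A \<noteq> {}"
  shows "log_fiber A U - log_fiber A (\<lambda>x. (U x, V x)) \<le> real (card A) * ln (real (card S))"
proof -
  have S: "card S > 0" using assms by (auto simp: card_gt_0_iff)
  have "(\<Sum>x\<in>A. ln (1 / real (card S))) \<le> log_fiber A (\<lambda>x. (U x, V x)) - log_fiber A U"
  proof (rule log_fiber_gibbs[OF assms(1)])
    show "(\<Sum>v\<in>V ` {y\<in>A. U y = U x}. 1 / real (card S)) \<le> 1" for x
    proof -
      have "card (V ` {y\<in>A. U y = U x}) \<le> card S" using assms by (intro card_mono) auto
      then show ?thesis using S by simp
    qed
  qed (use S in auto)
  then show ?thesis using S by (simp add: ln_div)
qed

section \<open>Cyclic shifts and residues\<close>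

lemma bij_betw_shift_mod:
  assumes "L > (0::nat)"
  shows "bij_betw (\<lambda>n. (n + s) mod L) {..<L} {..<L}"
proof (rule bij_betw_imageI)
  show inj: "inj_on (\<lambda>n. (n + s) mod L) {..<L}"
  proof (rule inj_onI)
    fix x y assume xy: "x \<in> {..<L}" "y \<in> {..<L}" "(x + s) mod L = (y + s) mod L"
    then have "[x + s = y + s] (mod L)" by (simp add: cong_def)
    then have "[x = y] (mod L)" by (simp add: cong_add_rcancel_nat)
    then show "x = y" using xy by (simp add: cong_def)
  qed
  show "(\<lambda>n. (n + s) mod L) ` {..<L} = {..<L}"
    by (rule card_subset_eq) (use assms inj in \<open>auto simp: card_image\<close>)
qed

lemma sum_shift_periodic:
  fixes g :: "nat \<Rightarrow> real"
  assumes "L > 0" "\<And>n. g (n mod L) = g n"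
  shows "(\<Sum>n<L. g (n + s)) = (\<Sum>n<L. g n)"
proof -
  have "(\<Sum>n<L. g (n + s)) = (\<Sum>n<L. g ((n + s) mod L))" by (simp add: assms)
  also have "\<dots> = (\<Sum>n<L. g n)" by (rule sum.reindex_bij_betw[OF bij_betw_shift_mod[OF assms(1)]])
  finally show ?thesis .
qed

lemma fiber_card_mod:
  assumes "R dvd L" "L > 0"
  shows "real (fiber_card {..<L} (\<lambda>n. n mod R) n) = real L / real R"
proof -
  obtain q where q: "L = R * q" using assms by blast
  then have R: "R > 0" "q > 0" using assms by auto
  have "{k\<in>{..<L}. k mod R = n mod R} = (\<lambda>j. n mod R + R * j) ` {..<q}"
  proof (intro equalityI subsetI)
    fix k assume k: "k \<in> {k\<in>{..<L}. k mod R = n mod R}"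
    then have "k = n mod R + R * (k div R)" by (metis (mono_tags, lifting) mem_Collect_eq mod_mult_div_eq)
    moreover have "k div R < q" using k q R by (simp add: less_mult_imp_div_less mult.commute)
    ultimately show "k \<in> (\<lambda>j. n mod R + R * j) ` {..<q}" by blast
  next
    fix k assume "k \<in> (\<lambda>j. n mod R + R * j) ` {..<q}"
    then obtain j where j: "k = n mod R + R * j" "j < q" by auto
    have "n mod R + R * j < R * (j + 1)" using R by simp
    also have "\<dots> \<le> R * q" using j by (intro mult_le_mono2) simp
    finally show "k \<in> {k\<in>{..<L}. k mod R = n mod R}" using j q by simp
  qed
  moreover have "inj_on (\<lambda>j. n mod R + R * j) {..<q}" using R by (auto simp: inj_on_def)
  ultimately have "fiber_card {..<L} (\<lambda>n. n mod R) n = q" by (simp add: fiber_card_def card_image)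
  then show ?thesis using q R by simp
qed

text \<open>As \<open>R\<close> divides \<open>L\<close>, the residue \<open>n mod R\<close> is
  uniformly distributed and has entropy \<open>ln R\<close>.\<close>

lemma log_fiber_mod:
  assumes "R dvd L" "L > 0"
  shows "log_fiber {..<L} (\<lambda>n. n mod R) = real L * (ln (real L) - ln (real R))"
proof -
  have "R > 0" using assms by (auto intro: Nat.gr0I)
  then show ?thesis using assms by (simp add: log_fiber_def fiber_card_mod ln_div)
qed

section \<open>The entropy decrement\<close>

definition window :: "(nat \<Rightarrow> 's) \<Rightarrow> nat \<Rightarrow> nat \<Rightarrow> 's list" where
  "window Z l n = map (\<lambda>i. Z (n + i)) [0..<l]"

lemma window_eq_iff: "window Z l n = window Z l n' \<longleftrightarrow> (\<forall>i<l. Z (n + i) = Z (n' + i))"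
  by (auto simp: window_def)

lemma length_window [simp]: "length (window Z l n) = l"
  by (simp add: window_def)

text \<open>\<open>L\<close> times the entropy of the window conditional on \<open>n mod R\<close>, for uniform \<open>n < L\<close>.\<close>
definition cond_entropy :: "nat \<Rightarrow> (nat \<Rightarrow> 's) \<Rightarrow> nat \<Rightarrow> nat \<Rightarrow> real" where
  "cond_entropy L Z l R = log_fiber {..<L} (\<lambda>n. n mod R) - log_fiber {..<L} (\<lambda>n. (n mod R, window Z l n))"

text \<open>\<open>L\<close> times the mutual information of the window and \<open>n mod R'\<close> conditional on \<open>n mod R\<close>,
  provided that \<open>R\<close> divides \<open>R'\<close>.\<close>
definition mutual_info :: "nat \<Rightarrow> (nat \<Rightarrow> 's) \<Rightarrow> nat \<Rightarrow> nat \<Rightarrow> nat \<Rightarrow> real" where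
  "mutual_info L Z l R R' = cond_entropy L Z l R - cond_entropy L Z l R'"

lemma cond_entropy_nonneg: "cond_entropy L Z l R \<ge> 0"
  unfolding cond_entropy_def
  using log_fiber_mono[of "{..<L}" "\<lambda>n. (n mod R, window Z l n)" "\<lambda>n. n mod R"] by simp

lemma cond_entropy_le:
  assumes "range Z \<subseteq> S" "finite S" "L > 0"
  shows "cond_entropy L Z l R \<le> real L * (real l * ln (real (card S)))"
proof -
  have "S \<noteq> {}" using assms(1) by blast
  have "cond_entropy L Z l R \<le> real (card {..<L}) * ln (real (card {xs. set xs \<subseteq> S \<and> length xs = l}))"
    unfolding cond_entropy_def
  proof (rule log_fiber_card_le)
    show "window Z l ` {..<L} \<subseteq> {xs. set xs \<subseteq> S \<and> length xs = l}"
    proof clarsimp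
      fix n z assume "z \<in> set (window Z l n)"
      then have "z \<in> range Z" unfolding window_def set_map by blast
      then show "z \<in> S" using assms(1) by blast
    qed
    show "{..<L} \<noteq> {}" using assms(3) by auto
    show "finite {xs. set xs \<subseteq> S \<and> length xs = l}" using assms(2) by (rule finite_lists_length_eq)
  qed simp
  also have "card {xs. set xs \<subseteq> S \<and> length xs = l} = card S ^ l"
    using assms(2) by (rule card_lists_length_eq)
  also have "ln (real (card S ^ l)) = real l * ln (real (card S))"
    using \<open>S \<noteq> {}\<close> assms(2) by (simp add: ln_realpow card_gt_0_iff)
  finally show ?thesis by simp
qed

text \<open>Since \<open>n mod R'\<close> determines \<open>n mod R\<close>, passing from
  \<open>R\<close> to \<open>R'\<close> conditions on more information, and strong subadditivity
  applies.\<close>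

lemma mutual_info_nonneg:
  assumes "R dvd R'"
  shows "mutual_info L Z l R R' \<ge> 0"
proof -
  let ?A = "{..<L}" and ?X = "window Z l"
  have *: "n mod R = k mod R" if "n mod R' = k mod R'" for n k
    using that assms by (metis mod_mod_cancel)
  have "log_fiber ?A (\<lambda>n. (n mod R, n mod R')) + log_fiber ?A (\<lambda>n. (n mod R, ?X n))
    \<le> log_fiber ?A (\<lambda>n. ((n mod R, ?X n), n mod R')) + log_fiber ?A (\<lambda>n. n mod R)"
    by (rule log_fiber_submodular) simp
  moreover have "log_fiber ?A (\<lambda>n. (n mod R, n mod R')) = log_fiber ?A (\<lambda>n. n mod R')"
    by (rule log_fiber_cong) (use * in blast)
  moreover have "log_fiber ?A (\<lambda>n. ((n mod R, ?X n), n mod R')) = log_fiber ?A (\<lambda>n. (n mod R', ?X n))"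
    by (rule log_fiber_cong) (use * in blast)
  ultimately show ?thesis by (simp add: mutual_info_def cond_entropy_def)
qed

text \<open>A window of length \<open>2 * l\<close> consists of two adjacent windows of length
  \<open>l\<close>, and conditional entropy is subadditive. Both halves have the same conditional
  entropy because the cyclic shift by \<open>l\<close> preserves the uniform distribution and
  permutes the residue classes modulo \<open>R\<close>.\<close>

lemma cond_entropy_double:
  assumes per: "\<And>n. Z (n mod L) = Z n" and R: "R dvd L" "L > 0"
  shows "cond_entropy L Z (2 * l) R \<le> 2 * cond_entropy L Z l R"
proof -
  let ?A = "{..<L}" and ?X = "window Z l" and ?W = "\<lambda>n. n mod R"
  have Zm: "Z ((n + s) mod L + i) = Z (n + s + i)" for n s i
  proof -
    have "Z ((n + s) mod L + i) = Z (((n + s) mod L + i) mod L)" by (rule per[symmetric])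
    also have "\<dots> = Z ((n + s + i) mod L)" by (simp only: mod_add_left_eq)
    finally show ?thesis by (simp only: per)
  qed
  have "log_fiber ?A (\<lambda>n. (?W n, ?X (n + l))) = log_fiber ?A (\<lambda>n. (?W ((n + l) mod L), ?X ((n + l) mod L)))"
  proof (rule log_fiber_cong)
    fix n k
    have "?W ((n + l) mod L) = ?W ((k + l) mod L) \<longleftrightarrow> [n + l = k + l] (mod R)"
      by (simp add: cong_def mod_mod_cancel[OF R(1)])
    also have "\<dots> \<longleftrightarrow> ?W n = ?W k" by (simp add: cong_add_rcancel_nat) (simp add: cong_def)
    finally show "(?W n, ?X (n + l)) = (?W k, ?X (k + l)) \<longleftrightarrow>
      (?W ((n + l) mod L), ?X ((n + l) mod L)) = (?W ((k + l) mod L), ?X ((k + l) mod L))"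
      by (simp add: window_eq_iff Zm)
  qed
  also have "\<dots> = log_fiber ?A (\<lambda>n. (?W n, ?X n))"
    by (rule log_fiber_reindex[OF bij_betw_shift_mod[OF R(2)]])
  finally have shift: "log_fiber ?A (\<lambda>n. (?W n, ?X (n + l))) = log_fiber ?A (\<lambda>n. (?W n, ?X n))" .
  have "log_fiber ?A (\<lambda>n. (?W n, ?X n)) + log_fiber ?A (\<lambda>n. (?W n, ?X (n + l)))
    \<le> log_fiber ?A (\<lambda>n. ((?W n, ?X (n + l)), ?X n)) + log_fiber ?A ?W"
    by (rule log_fiber_submodular) simp
  moreover have "log_fiber ?A (\<lambda>n. ((?W n, ?X (n + l)), ?X n)) = log_fiber ?A (\<lambda>n. (?W n, window Z (2 * l) n))"
  proof (rule log_fiber_cong)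
    fix n k
    have double: "window Z (2 * l) m = ?X m @ ?X (m + l)" for m
      by (rule nth_equalityI) (auto simp: window_def nth_append add.assoc)
    show "((?W n, ?X (n + l)), ?X n) = ((?W k, ?X (k + l)), ?X k) \<longleftrightarrow>
        (?W n, window Z (2 * l) n) = (?W k, window Z (2 * l) k)"
      unfolding double by auto
  qed
  ultimately show ?thesis by (simp add: cond_entropy_def shift)
qed

text \<open>The entropy decrement. Refining the modulus from \<open>R m\<close> to
  \<open>R (m + 1)\<close> lowers the conditional entropy \<open>?D m\<close> by the mutual
  information, and doubling the window then at most doubles what is left. Hence
  \<open>?D m / 2 ^ m\<close> drops at each scale by at least the summand, and the drops
  telescope.\<close>

lemma sum_mutual_info_le:
  assumes per: "\<And>n. Z (n mod L) = Z n" and "L > 0"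
    and R: "\<And>m. m \<in> {1..M + 1} \<Longrightarrow> R m dvd L"
    and S: "range Z \<subseteq> S" "finite S"
  shows "(\<Sum>m=1..M. mutual_info L Z (l * 2 ^ m) (R m) (R (m + 1)) / 2 ^ m) \<le> real L * (real l * ln (real (card S)))"
proof -
  let ?D = "\<lambda>m. cond_entropy L Z (l * 2 ^ m) (R m)"
  have "(\<Sum>m=1..k. mutual_info L Z (l * 2 ^ m) (R m) (R (m + 1)) / 2 ^ m) \<le> ?D 1 / 2 - ?D (k + 1) / 2 ^ (k + 1)"
    if "k \<le> M" for k
    using that
  proof (induction k)
    case (Suc k)
    let ?I = "mutual_info L Z (l * 2 ^ Suc k) (R (Suc k)) (R (Suc k + 1))"
    have "R (Suc k + 1) dvd L" using Suc.prems by (intro R) auto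
    then have "cond_entropy L Z (2 * (l * 2 ^ Suc k)) (R (Suc k + 1)) \<le> 2 * cond_entropy L Z (l * 2 ^ Suc k) (R (Suc k + 1))"
      by (intro cond_entropy_double) (simp_all add: per \<open>L > 0\<close>)
    then have "?D (Suc k + 1) \<le> 2 * (?D (Suc k) - ?I)"
      by (simp add: mutual_info_def mult.left_commute)
    then have "?I / 2 ^ Suc k \<le> ?D (Suc k) / 2 ^ Suc k - ?D (Suc k + 1) / 2 ^ (Suc k + 1)"
      by (simp add: field_simps)
    then show ?case using Suc by simp
  qed simp
  from this[of M] have "(\<Sum>m=1..M. mutual_info L Z (l * 2 ^ m) (R m) (R (m + 1)) / 2 ^ m) \<le> ?D 1 / 2 - ?D (M + 1) / 2 ^ (M + 1)"
    by simp
  also have "\<dots> \<le> ?D 1 / 2" using cond_entropy_nonneg[of L Z "l * 2 ^ (M + 1)" "R (M + 1)"] by simp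
  also have "\<dots> \<le> real L * (real l * ln (real (card S)))"
    using cond_entropy_le[OF S \<open>L > 0\<close>, of "l * 2 ^ 1" "R 1"] by simp
  finally show ?thesis .
qed

section \<open>Independence of residues and exponential moments\<close>

text \<open>By the Chinese remainder theorem, \<open>n < a * b\<close> corresponds bijectively to
  the pair of its residues, so that the sum factorizes.\<close>

lemma sum_mult_coprime:
  fixes F G :: "nat \<Rightarrow> real"
  assumes cop: "coprime a b" and "a > 0" "b > 0"
    and F: "\<And>n. F (n mod a) = F n" and G: "\<And>n. G (n mod b) = G n"
  shows "(\<Sum>n<a * b. F n * G n) = (\<Sum>n<a. F n) * (\<Sum>n<b. G n)"
proof -
  have inj: "inj_on (\<lambda>n. (n mod a, n mod b)) {..<a * b}"
  proof (rule inj_onI)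
    fix x y assume xy: "x \<in> {..<a * b}" "y \<in> {..<a * b}" "(x mod a, x mod b) = (y mod a, y mod b)"
    then have "[x = y] (mod a)" "[x = y] (mod b)" by (auto simp: cong_def)
    then have "[x = y] (mod (a * b))" using cop by (simp add: coprime_cong_mult_nat)
    then show "x = y" using xy by (simp add: cong_def)
  qed
  have "(\<lambda>n. (n mod a, n mod b)) ` {..<a * b} = {..<a} \<times> {..<b}"
    by (rule card_subset_eq) (use inj assms in \<open>auto simp: card_image\<close>)
  with inj have bij: "bij_betw (\<lambda>n. (n mod a, n mod b)) {..<a * b} ({..<a} \<times> {..<b})"
    by (simp add: bij_betw_def)
  have "(\<Sum>n<a * b. F n * G n) = (\<Sum>n<a * b. (\<lambda>(x, y). F x * G y) (n mod a, n mod b))"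
    by (simp add: F G)
  also have "\<dots> = (\<Sum>(x, y)\<in>{..<a} \<times> {..<b}. F x * G y)"
    by (rule sum.reindex_bij_betw[OF bij])
  also have "\<dots> = (\<Sum>n<a. F n) * (\<Sum>n<b. G n)"
    by (simp add: sum.cartesian_product[symmetric] sum_product)
  finally show ?thesis .
qed

lemma sum_prod_primes:
  fixes h :: "nat \<Rightarrow> nat \<Rightarrow> real"
  assumes "finite A" "\<And>p. p \<in> A \<Longrightarrow> prime p" "\<And>p n. p \<in> A \<Longrightarrow> h p (n mod p) = h p n"
  shows "(\<Sum>n<\<Prod>A. \<Prod>p\<in>A. h p n) = (\<Prod>p\<in>A. \<Sum>n<p. h p n)"
  using assms
proof (induction A rule: finite_induct)
  case empty
  then show ?case by (simp add: lessThan_Suc)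
next
  case (insert p A)
  have pos: "p > 0" "\<Prod>A > 0" using insert by (auto simp: prime_gt_0_nat intro!: prod_pos)
  have cop: "coprime p (\<Prod>A)"
    by (rule prod_coprime_right) (use insert in \<open>auto intro!: primes_coprime\<close>)
  have "(\<Sum>n<p * \<Prod>A. h p n * (\<Prod>q\<in>A. h q n)) = (\<Sum>n<p. h p n) * (\<Sum>n<\<Prod>A. \<Prod>q\<in>A. h q n)"
  proof (rule sum_mult_coprime[OF cop pos])
    show "h p (n mod p) = h p n" for n using insert.prems by simp
    show "(\<Prod>q\<in>A. h q (n mod \<Prod>A)) = (\<Prod>q\<in>A. h q n)" for n
    proof (rule prod.cong[OF refl])
      fix q assume q: "q \<in> A"
      then have "q dvd \<Prod>A" using insert.hyps by (intro dvd_prodI[of A q id, simplified]) auto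
      then have "(n mod \<Prod>A) mod q = n mod q" by (rule mod_mod_cancel)
      then show "h q (n mod \<Prod>A) = h q n"
        using insert.prems(2)[of q n] insert.prems(2)[of q "n mod \<Prod>A"] q by simp
    qed
  qed
  then show ?case using insert by simp
qed

lemma exp_le_quadratic:
  fixes u :: real
  assumes "\<bar>u\<bar> \<le> 1"
  shows "exp u \<le> 1 + u + u\<^sup>2"
proof (cases "u \<ge> 0")
  case True
  then show ?thesis using assms by (intro exp_bound) auto
next
  case False
  define v where "v = - u"
  have v: "0 \<le> v" "v \<le> 1" using False assms by (auto simp: v_def)
  have "1 \<le> (1 - v + v\<^sup>2) * (1 + v)"
  proof -
    have "(1 - v + v\<^sup>2) * (1 + v) = 1 + v ^ 3"
      by (simp add: algebra_simps power2_eq_square power3_eq_cube)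
    then show ?thesis using v by simp
  qed
  also have "\<dots> \<le> (1 - v + v\<^sup>2) * exp v"
  proof (intro mult_left_mono exp_ge_add_one_self)
    show "0 \<le> 1 - v + v\<^sup>2" using v zero_le_power2[of v] by linarith
  qed
  finally show ?thesis by (simp add: v_def exp_minus field_simps)
qed

text \<open>Hoeffding's bound up to the constant in the exponent: in
  \<open>exp u \<le> 1 + u + u ^ 2\<close> the linear terms sum to zero.\<close>

lemma exp_moment_le:
  fixes g :: "nat \<Rightarrow> real"
  assumes "\<And>v. v < p \<Longrightarrow> \<bar>g v\<bar> \<le> c" "c \<le> 1" "(\<Sum>v<p. g v) = 0"
  shows "(\<Sum>v<p. exp (g v)) \<le> real p * exp (c\<^sup>2)"
proof -
  have "(\<Sum>v<p. exp (g v)) \<le> (\<Sum>v<p. g v + (1 + c\<^sup>2))"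
  proof (rule sum_mono)
    fix v assume "v \<in> {..<p}"
    then have v: "\<bar>g v\<bar> \<le> c" using assms by auto
    then have "(g v)\<^sup>2 \<le> c\<^sup>2" by (simp add: abs_le_square_iff[symmetric])
    moreover have "exp (g v) \<le> 1 + g v + (g v)\<^sup>2" using v assms by (intro exp_le_quadratic) auto
    ultimately show "exp (g v) \<le> g v + (1 + c\<^sup>2)" by simp
  qed
  also have "\<dots> = real p * (1 + c\<^sup>2)" by (simp add: sum.distrib assms)
  also have "\<dots> \<le> real p * exp (c\<^sup>2)" by (intro mult_left_mono exp_ge_add_one_self) auto
  finally show ?thesis .
qed

section \<open>Bounding the bilinear sum by mutual information\<close>

text \<open>The weight \<open>p\<close> on the multiples of \<open>p\<close> has mean 1 over a
  period, so \<open>sieve p\<close> has mean 0 and detects a bias of a sum towards the multiples of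
  \<open>p\<close>.\<close>

definition sieve :: "nat \<Rightarrow> nat \<Rightarrow> real" where
  "sieve p n = 1 - (if p dvd n then real p else 0)"

lemma sieve_mod:
  assumes "p dvd L"
  shows "sieve p (n mod L + i) = sieve p (n + i)"
proof -
  have "(n mod L + i) mod p = (n mod L mod p + i) mod p" by (rule mod_add_left_eq[symmetric])
  also have "\<dots> = (n + i) mod p" by (simp add: mod_mod_cancel[OF assms] mod_add_left_eq)
  finally show ?thesis by (simp add: sieve_def dvd_eq_mod_eq_0)
qed

lemma sum_sieve_eq_0:
  assumes "p > 0"
  shows "(\<Sum>v<p. sieve p (v + i)) = 0"
proof -
  have "(\<Sum>v<p. sieve p (v + i)) = (\<Sum>v<p. sieve p v)"
    by (rule sum_shift_periodic) (use assms sieve_mod[of p p _ 0] in auto)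
  also have "\<dots> = real p - (\<Sum>v<p. if p dvd v then real p else 0)"
    by (simp add: sieve_def sum_subtractf)
  also have "(\<Sum>v<p. if p dvd v then real p else 0) = (\<Sum>v<p. if v = 0 then real p else 0)"
    by (rule sum.cong) (auto dest: dvd_imp_le)
  finally show ?thesis using assms by simp
qed

text \<open>Because \<open>J < p\<close>, at most one of \<open>J\<close> consecutive integers is a
  multiple of \<open>p\<close>, and it adds \<open>p \<le> 2 * J\<close> to a sum of
  \<open>J\<close> ones.\<close>

lemma sum_abs_sieve_le:
  assumes "J < p" "p \<le> 2 * J"
  shows "(\<Sum>i<J. \<bar>sieve p (v + i)\<bar>) \<le> 3 * real J"
proof -
  have "card {i\<in>{..<J}. p dvd v + i} \<le> Suc 0"
  proof (rule card_le_Suc0_iff_eq[THEN iffD2], simp, intro ballI)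
    fix i j assume ij: "i \<in> {i\<in>{..<J}. p dvd v + i}" "j \<in> {i\<in>{..<J}. p dvd v + i}"
    then have "[v + i = v + j] (mod p)" by (auto simp: cong_def dvd_eq_mod_eq_0)
    then have "[i = j] (mod p)" by (simp add: cong_add_lcancel_nat)
    then show "i = j" using ij assms by (simp add: cong_def)
  qed
  then have le: "real (card {i\<in>{..<J}. p dvd v + i}) * real p \<le> 1 * real p"
    by (intro mult_right_mono) simp_all
  have "(\<Sum>i<J. \<bar>sieve p (v + i)\<bar>) \<le> (\<Sum>i<J. 1 + (if p dvd v + i then real p else 0))"
    by (rule sum_mono) (auto simp: sieve_def)
  also have "\<dots> = real J + real (card {i\<in>{..<J}. p dvd v + i}) * real p"
    by (simp add: sum.distrib sum.inter_filter[symmetric])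
  also have "\<dots> \<le> 3 * real J" using le assms(2) by linarith
  finally show ?thesis .
qed

text \<open>The Donsker--Varadhan inequality: a law on the residues modulo \<open>\<Prod>P\<close>,
  tilted by the bilinear form, competes with their law given the window and \<open>n mod R\<close>.
  Independence of the residues modulo different primes and the Hoeffding bound control its
  normalization.\<close>

lemma sum_sieve_le_mutual_info:
  fixes \<psi> :: "nat \<Rightarrow> nat \<Rightarrow> real"
  assumes per: "\<And>n. Z (n mod L) = Z n" "\<And>p n. p \<in> P \<Longrightarrow> \<psi> p (n mod L) = \<psi> p n" and "L > 0"
    and R: "coprime R (\<Prod>P)" "R * \<Prod>P dvd L"
    and P: "finite P" "\<And>p. p \<in> P \<Longrightarrow> prime p \<and> J < p \<and> p \<le> 2 * J" and "J > 0"
    and le1: "\<And>p n. p \<in> P \<Longrightarrow> \<bar>\<psi> p n\<bar> \<le> 1"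
    and local: "\<And>p n n' i. p \<in> P \<Longrightarrow> i < J \<Longrightarrow> window Z l n = window Z l n' \<Longrightarrow> \<psi> p (n + i) = \<psi> p (n' + i)"
    and t: "0 < t" "t \<le> 1 / 3"
  shows "t * (\<Sum>p\<in>P. \<Sum>n<L. \<psi> p n * sieve p n)
    \<le> mutual_info L Z l R (R * \<Prod>P) + 9 * t\<^sup>2 * real (card P) * real L"
proof -
  let ?A = "{..<L}" and ?X = "window Z l"
  define q where "q = \<Prod>P"
  \<comment> \<open>Each prime adds \<open>(3 * t) ^ 2\<close> to the bound for the logarithm of the
    exponential moment, since \<open>\<bar>g n p v\<bar> \<le> 3 * t \<le> 1\<close>.\<close>
  define \<kappa> where "\<kappa> = 9 * t\<^sup>2 * real (card P)"
  \<comment> \<open>The average over \<open>J\<close> consecutive sites depends on \<open>n\<close>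
    only through the window and is of order \<open>t\<close>, whereas a single value of
    \<open>sieve p\<close> can be as large as \<open>p - 1\<close> in absolute value.\<close>
  define g where "g n p v = t / real J * (\<Sum>i<J. \<psi> p (n + i) * sieve p (v + i))" for n p v
  define w where "w n v = exp ((\<Sum>p\<in>P. g n p v) - \<kappa>) / real q" for n v
  have Qpos: "q > 0" unfolding q_def using P by (auto simp: prime_gt_0_nat intro!: prod_pos)
  have dvdq: "p dvd q" if "p \<in> P" for p
    using dvd_prodI[OF P(1) that, of id] by (simp add: q_def)
  have dvdL: "p dvd L" if "p \<in> P" for p
    using dvd_trans[OF dvdq[OF that] dvd_trans[OF dvd_triv_right R(2)[folded q_def]]] .
  have moment: "(\<Sum>v<q. exp (\<Sum>p\<in>P. g n p v)) \<le> real q * exp \<kappa>" for n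
  proof -
    have "(\<Sum>v<q. exp (\<Sum>p\<in>P. g n p v)) = (\<Sum>v<q. \<Prod>p\<in>P. exp (g n p v))"
      by (simp add: exp_sum P(1))
    also have "\<dots> = (\<Prod>p\<in>P. \<Sum>v<p. exp (g n p v))"
      unfolding q_def by (rule sum_prod_primes[OF P(1)]) (use P(2) in \<open>simp_all add: g_def sieve_mod\<close>)
    also have "\<dots> \<le> (\<Prod>p\<in>P. real p * exp ((3 * t)\<^sup>2))"
    proof (intro prod_mono conjI sum_nonneg exp_moment_le)
      fix p assume p: "p \<in> P"
      then have "p > 0" using P(2) prime_gt_0_nat by blast
      show "\<bar>g n p v\<bar> \<le> 3 * t" for v
      proof -
        have "\<bar>\<Sum>i<J. \<psi> p (n + i) * sieve p (v + i)\<bar> \<le> (\<Sum>i<J. \<bar>\<psi> p (n + i) * sieve p (v + i)\<bar>)"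
          by (rule sum_abs)
        also have "\<dots> \<le> (\<Sum>i<J. \<bar>sieve p (v + i)\<bar>)"
          using le1[OF p] by (intro sum_mono) (simp add: abs_mult mult_left_le_one_le)
        also have "\<dots> \<le> 3 * real J" using P(2)[OF p] by (intro sum_abs_sieve_le) auto
        finally have "t / real J * \<bar>\<Sum>i<J. \<psi> p (n + i) * sieve p (v + i)\<bar> \<le> t / real J * (3 * real J)"
          using t by (intro mult_left_mono) auto
        then show ?thesis using t \<open>J > 0\<close> by (simp add: g_def abs_mult)
      qed
      have "(\<Sum>v<p. g n p v) = t / real J * (\<Sum>i<J. \<psi> p (n + i) * (\<Sum>v<p. sieve p (v + i)))"
        unfolding g_def sum_distrib_left by (subst sum.swap) (rule refl)
      then show "(\<Sum>v<p. g n p v) = 0" by (simp add: sum_sieve_eq_0 \<open>p > 0\<close>)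
      show "3 * t \<le> 1" using t by simp
    qed auto
    also have "\<dots> = real q * exp \<kappa>"
      by (simp add: q_def prod.distrib exp_of_nat_mult[symmetric] \<kappa>_def power_mult_distrib mult_ac)
    finally show ?thesis .
  qed
  have "(\<Sum>n<L. ln (w n (n mod q))) \<le> log_fiber ?A (\<lambda>n. ((n mod R, ?X n), n mod q)) - log_fiber ?A (\<lambda>n. (n mod R, ?X n))"
  proof (rule log_fiber_gibbs)
    show "w n (n mod q) > 0" for n using Qpos by (simp add: w_def)
    show "w n = w n'" if "(n mod R, ?X n) = (n' mod R, ?X n')" for n n'
    proof -
      have "g n p v = g n' p v" if "p \<in> P" for p v
        unfolding g_def using local[OF that, of _ n n'] \<open>(n mod R, ?X n) = _\<close> by simp
      then show ?thesis by (simp add: w_def fun_eq_iff)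
    qed
    show "(\<Sum>v\<in>(\<lambda>n. n mod q) ` {k\<in>?A. (k mod R, ?X k) = (n mod R, ?X n)}. w n v) \<le> 1" for n
    proof -
      have "(\<Sum>v\<in>(\<lambda>n. n mod q) ` {k\<in>?A. (k mod R, ?X k) = (n mod R, ?X n)}. w n v) \<le> (\<Sum>v<q. w n v)"
        using Qpos by (intro sum_mono2) (auto simp: w_def)
      also have "\<dots> = (\<Sum>v<q. exp (\<Sum>p\<in>P. g n p v)) / (real q * exp \<kappa>)"
        by (simp add: w_def exp_diff sum_divide_distrib mult.commute)
      also have "\<dots> \<le> 1" using moment[of n] Qpos by (subst divide_le_eq_1_pos) (simp_all only: mult_pos_pos of_nat_0_less_iff exp_gt_zero)
      finally show ?thesis .
    qed
  qed simp
  moreover have "(\<Sum>n<L. ln (w n (n mod q))) = t * (\<Sum>p\<in>P. \<Sum>n<L. \<psi> p n * sieve p n) - real L * \<kappa> - real L * ln (real q)"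
  proof -
    \<comment> \<open>At the true residue \<open>v = n mod q\<close> every shift \<open>i\<close>
      yields the same cyclic sum, so the average over the shifts changes nothing.\<close>
    have "(\<Sum>n<L. g n p (n mod q)) = t * (\<Sum>n<L. \<psi> p n * sieve p n)" if p: "p \<in> P" for p
    proof -
      have "(\<Sum>n<L. g n p (n mod q)) = t / real J * (\<Sum>n<L. \<Sum>i<J. \<psi> p (n + i) * sieve p (n + i))"
        by (simp add: g_def sieve_mod[OF dvdq[OF p]] sum_distrib_left)
      also have "(\<Sum>n<L. \<Sum>i<J. \<psi> p (n + i) * sieve p (n + i)) = (\<Sum>i<J. \<Sum>n<L. \<psi> p (n + i) * sieve p (n + i))"
        by (rule sum.swap)
      also have "\<dots> = (\<Sum>i<J. \<Sum>n<L. \<psi> p n * sieve p n)"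
      proof (rule sum.cong[OF refl])
        show "(\<Sum>n<L. \<psi> p (n + i) * sieve p (n + i)) = (\<Sum>n<L. \<psi> p n * sieve p n)" for i
          by (rule sum_shift_periodic[OF \<open>L > 0\<close>]) (use per(2)[OF p] sieve_mod[OF dvdL[OF p], of _ 0] in simp)
      qed
      finally show ?thesis using \<open>J > 0\<close> by simp
    qed
    then have "(\<Sum>n<L. \<Sum>p\<in>P. g n p (n mod q)) = t * (\<Sum>p\<in>P. \<Sum>n<L. \<psi> p n * sieve p n)"
      by (subst sum.swap) (simp add: sum_distrib_left)
    then show ?thesis
      using Qpos by (simp add: w_def ln_div sum_subtractf)
  qed
  moreover have "log_fiber ?A (\<lambda>n. ((n mod R, ?X n), n mod q)) = log_fiber ?A (\<lambda>n. (n mod (R * q), ?X n))"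
  proof (rule log_fiber_cong)
    fix n k
    have "n mod (R * q) = k mod (R * q) \<longleftrightarrow> n mod R = k mod R \<and> n mod q = k mod q"
      using coprime_cong_mult_nat[OF _ _ R(1)[folded q_def], of n k] cong_modulus_mult_nat[of n k R q] cong_modulus_mult_nat[of n k q R]
      by (auto simp: cong_def mult.commute)
    then show "((n mod R, ?X n), n mod q) = ((k mod R, ?X k), k mod q) \<longleftrightarrow>
        (n mod (R * q), ?X n) = (k mod (R * q), ?X k)"
      by blast
  qed
  \<comment> \<open>The entropy \<open>ln q\<close> of the uniform residue modulo \<open>q\<close>;
    it cancels the normalization \<open>1 / q\<close> in \<open>w\<close>.\<close>
  moreover have "log_fiber ?A (\<lambda>n. n mod R) - log_fiber ?A (\<lambda>n. n mod (R * q)) = real L * ln (real q)"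
  proof -
    have "R > 0" using R(2) \<open>L > 0\<close> by (cases R) auto
    moreover have "R dvd L" using R(2) by (rule dvd_mult_left)
    ultimately show ?thesis using R(2)[folded q_def] \<open>L > 0\<close> Qpos
      by (simp add: log_fiber_mod ln_mult algebra_simps)
  qed
  ultimately show ?thesis
    unfolding mutual_info_def cond_entropy_def \<kappa>_def q_def[symmetric] by (simp add: algebra_simps)
qed

section \<open>Reduction to blocks\<close>

lemma liouville_mult:
  assumes "m > 0" "n > 0"
  shows "liouville (m * n) = liouville m * liouville n"
  using assms by (simp add: liouville_def prime_factorization_mult power_add)

lemma liouville_prime: "prime p \<Longrightarrow> liouville p = -1"
  by (simp add: liouville_def prime_factorization_prime)

lemma liouville_in: "liouville n \<in> {-1, 1}"
  by (simp add: liouville_def minus_one_power_iff)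

definition corr :: "nat \<Rightarrow> (nat \<Rightarrow> nat) \<Rightarrow> (nat \<Rightarrow> nat) \<Rightarrow> nat \<Rightarrow> nat \<Rightarrow> real" where
  "corr k as bs a n = (\<Prod>i=1..k. of_int (liouville (as i * n + a * bs i)))"

lemma abs_prod_liouville [simp]: "\<bar>\<Prod>i\<in>A. real_of_int (liouville (f i))\<bar> = 1"
proof -
  have "\<bar>real_of_int (liouville n)\<bar> = 1" for n using liouville_in[of n] by auto
  then show ?thesis by (simp add: abs_prod)
qed

lemma abs_corr [simp]: "\<bar>corr k as bs a n\<bar> = 1"
  by (simp add: corr_def)

text \<open>All \<open>k\<close> arguments acquire the factor \<open>p\<close>. Positivity of
  \<open>a\<close> and \<open>bs i\<close> keeps them away from 0, where
  \<open>liouville 0 = 1\<close> breaks multiplicativity.\<close>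

lemma corr_mult_prime:
  assumes "prime p" "a \<ge> 1" "\<And>i. i \<in> {1..k} \<Longrightarrow> bs i \<ge> 1"
  shows "corr k as bs (a * p) (p * n) = (-1) ^ k * corr k as bs a n"
proof -
  have "corr k as bs (a * p) (p * n) = (\<Prod>i=1..k. - of_int (liouville (as i * n + a * bs i)))"
    unfolding corr_def
  proof (rule prod.cong[OF refl])
    fix i assume "i \<in> {1..k}"
    then have "as i * n + a * bs i > 0" using assms(2) assms(3)[of i] by simp
    then have "liouville (p * (as i * n + a * bs i)) = - liouville (as i * n + a * bs i)"
      using assms(1) by (simp add: liouville_mult liouville_prime prime_gt_0_nat)
    moreover have "as i * (p * n) + a * p * bs i = p * (as i * n + a * bs i)"
      by (simp add: algebra_simps)
    ultimately show "real_of_int (liouville (as i * (p * n) + a * p * bs i)) = - of_int (liouville (as i * n + a * bs i))"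
      by simp
  qed
  also have "\<dots> = (-1) ^ k * corr k as bs a n"
    by (simp add: corr_def prod_uminus)
  finally show ?thesis .
qed

lemma harm_le_ln:
  assumes "n \<ge> 1"
  shows "harm n \<le> 1 + ln (real n)"
proof -
  obtain m where m: "n = Suc m" using assms by (cases n) auto
  have "harm (Suc m) - ln (real (Suc m)) \<le> harm (Suc 0) - ln (real (Suc 0))"
    by (rule decseqD[OF decseq_harm_diff_ln]) simp
  moreover have "harm (Suc 0) = (1::real)" by (simp add: harm_def)
  ultimately show ?thesis using m by simp
qed

lemma harm_eq_sum: "harm n = (\<Sum>i=1..n. 1 / real i)"
  by (simp add: harm_def inverse_eq_divide)

lemma liouville_corr_eq:
  assumes "x \<ge> 0"
  shows "liouville_corr k as bs x a = (\<Sum>n=1..nat \<lfloor>x\<rfloor>. corr k as bs a n / real n) / harm (nat \<lfloor>x\<rfloor>)"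
proof -
  have le: "real n \<le> x \<longleftrightarrow> n \<le> nat \<lfloor>x\<rfloor>" for n using assms by linarith
  have "{n. 1 \<le> n \<and> real n \<le> x} = {1..nat \<lfloor>x\<rfloor>}"
    by (rule set_eqI) (simp only: mem_Collect_eq atLeastAtMost_iff le)
  then show ?thesis unfolding liouville_corr_def log_avg_def corr_def harm_eq_sum by (rule arg_cong)
qed

text \<open>The terms with \<open>p dvd n\<close>, weighted by \<open>p\<close>, reproduce the sum
  for \<open>a\<close> cut off at \<open>N div p\<close> instead of \<open>N\<close>. The missing
  terms have total harmonic weight at most \<open>1 + ln p\<close>.\<close>

lemma dilation_error:
  assumes "prime p" "a \<ge> 1" "\<And>i. i \<in> {1..k} \<Longrightarrow> bs i \<ge> 1" "N \<ge> 1"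
  shows "\<bar>(\<Sum>n=1..N. corr k as bs (a * p) n / real n) - (-1) ^ k * (\<Sum>n=1..N. corr k as bs a n / real n)
     - (\<Sum>n=1..N. corr k as bs (a * p) n * sieve p n / real n)\<bar> \<le> 1 + ln (real p)"
proof -
  let ?g = "\<lambda>n. corr k as bs a n / real n" and ?G = "corr k as bs (a * p)"
  define M where "M = N div p"
  have p: "p > 0" using assms prime_gt_0_nat by blast
  have MN: "M \<le> N" by (simp add: M_def)
  have "(\<Sum>n=1..N. ?G n / real n) - (\<Sum>n=1..N. ?G n * sieve p n / real n)
      = (\<Sum>n=1..N. if p dvd n then ?G n * real p / real n else 0)"
    unfolding sum_subtractf[symmetric] by (rule sum.cong) (auto simp: sieve_def diff_divide_distrib right_diff_distrib)
  also have "\<dots> = (\<Sum>j=1..M. ?G (p * j) * real p / real (p * j))"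
    unfolding M_def by (rule sum_multiples[OF p])
  also have "\<dots> = (\<Sum>j=1..M. (-1) ^ k * ?g j)"
  proof (rule sum.cong[OF refl])
    fix j
    have "?G (p * j) = (-1) ^ k * corr k as bs a j"
      by (rule corr_mult_prime) (use assms in auto)
    then show "?G (p * j) * real p / real (p * j) = (-1) ^ k * ?g j" using p by simp
  qed
  also have "\<dots> = (-1) ^ k * (\<Sum>j=1..M. ?g j)" by (simp add: sum_distrib_left)
  finally have "(\<Sum>n=1..N. ?G n / real n) - (-1) ^ k * (\<Sum>n=1..N. ?g n) - (\<Sum>n=1..N. ?G n * sieve p n / real n)
     = (-1) ^ k * ((\<Sum>j=1..M. ?g j) - (\<Sum>n=1..N. ?g n))"
    by (simp add: algebra_simps)
  also have "\<bar>\<dots>\<bar> = \<bar>\<Sum>n\<in>{M+1..N}. ?g n\<bar>"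
  proof -
    have "{1..N} = {1..M} \<union> {M+1..N}" using MN by auto
    then have "(\<Sum>n=1..N. ?g n) = (\<Sum>j=1..M. ?g j) + (\<Sum>n\<in>{M+1..N}. ?g n)"
      by (simp only:) (rule sum.union_disjoint, auto)
    then show ?thesis by (simp add: abs_mult power_abs)
  qed
  also have "\<dots> \<le> (\<Sum>n\<in>{M+1..N}. \<bar>?g n\<bar>)" by (rule sum_abs)
  also have "\<dots> = (\<Sum>n\<in>{M+1..N}. 1 / real n)" by simp
  also have "\<dots> = harm N - harm M"
  proof -
    have "{1..N} = {1..M} \<union> {M+1..N}" using MN by auto
    then have "harm N = harm M + (\<Sum>n\<in>{M+1..N}. 1 / real n)"
      unfolding harm_eq_sum by (simp only:) (rule sum.union_disjoint, auto)
    then show ?thesis by simp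
  qed
  also have "\<dots> \<le> 1 + ln (real N) - ln (real M + 1)"
    using harm_le_ln[OF assms(4)] harm_ge_ln[of M] by linarith
  also have "ln (real N) \<le> ln ((real M + 1) * real p)"
  proof (rule ln_mono)
    have "N < (M + 1) * p" using p by (simp add: M_def dividend_less_times_div algebra_simps)
    then have "real N \<le> real ((M + 1) * p)" by (simp only: of_nat_le_iff)
    then show "real N \<le> (real M + 1) * real p" by (simp only: of_nat_mult of_nat_add of_nat_1)
  qed (use assms in simp)
  also have "1 + ln ((real M + 1) * real p) - ln (real M + 1) = 1 + ln (real p)"
    using p by (simp add: ln_mult)
  finally show ?thesis by simp
qed

section \<open>From harmonic weights to uniform blocks\<close>

lemma sum_multiples_weight_period:
  assumes "p dvd L" "L > 0" "p > 0"
  shows "(\<Sum>r<L. 1 + (if p dvd j * L + r then real p else 0)) = 2 * real L"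
proof -
  obtain q where q: "L = p * q" using assms(1) by blast
  have "(\<Sum>r<L. if p dvd j * L + r then real p else 0) = (\<Sum>r<L. if p dvd r then real p else 0)"
    using assms(1) by (intro sum.cong refl) (simp add: dvd_add_right_iff)
  also have "\<dots> = (\<Sum>i<q. \<Sum>r\<in>{i * p..<i * p + p}. if p dvd r then real p else 0)"
    unfolding q by (subst mult.commute, rule sum.nat_group[symmetric])
  also have "\<dots> = (\<Sum>i<q. real p)"
  proof (rule sum.cong[OF refl])
    fix i
    have "(\<Sum>r\<in>{i * p..<i * p + p}. if p dvd r then real p else 0)
        = (\<Sum>r\<in>{i * p..<i * p + p}. if r = i * p then real p else 0)"
    proof (rule sum.cong[OF refl])
      fix r assume r: "r \<in> {i * p..<i * p + p}"
      have "p dvd r \<longleftrightarrow> r = i * p"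
      proof
        assume "p dvd r"
        then have "p dvd r - i * p" by simp
        moreover have "r - i * p < p" using r by auto
        ultimately have "r - i * p = 0" by (meson nat_dvd_not_less not_gr_zero)
        then show "r = i * p" using r by simp
      qed simp
      then show "(if p dvd r then real p else 0) = (if r = i * p then real p else 0)" by simp
    qed
    also have "\<dots> = real p" using assms(3) by simp
    finally show "(\<Sum>r\<in>{i * p..<i * p + p}. if p dvd r then real p else 0) = real p" .
  qed
  finally show ?thesis by (simp add: sum.distrib q)
qed

text \<open>The term \<open>j = 0\<close> of the sum over blocks vanishes because of \<open>x / 0 = 0\<close>.\<close>
lemma block_error:
  fixes G :: "nat \<Rightarrow> real"
  assumes "p dvd L" "L > 0" and G: "\<And>n. \<bar>G n\<bar> \<le> \<bar>sieve p n\<bar>"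
  shows "\<bar>(\<Sum>n=1..N. G n / real n) - (\<Sum>j<Suc (N div L). (\<Sum>r<L. G (j * L + r)) / (real j * real L))\<bar>
    \<le> 2 * harm L + 4"
proof -
  define J where "J = N div L"
  \<comment> \<open>A majorant of \<open>\<bar>G\<bar>\<close> whose sum over every full block is
    \<open>2 * L\<close>, independently of \<open>p\<close>; a pointwise bound would lose a factor
    \<open>p\<close>.\<close>
  define u where "u n = 1 + (if p dvd n then real p else 0)" for n
  define h where "h n = (if n \<le> N then 1 / real n else 0) - 1 / (real (n div L) * real L)" for n
  have p: "p > 0" using assms(1,2) by (cases p) auto
  have u: "\<bar>G n\<bar> \<le> u n" for n using G[of n] by (auto simp: u_def sieve_def split: if_splits)
  have NJ: "N < Suc J * L" using assms(2) by (simp add: J_def dividend_less_times_div algebra_simps)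
  \<comment> \<open>In a block \<open>j \<ge> 1\<close> the weight \<open>1 / n\<close> lies between
    \<open>1 / ((j + 1) * L)\<close> and \<open>1 / (j * L)\<close>, so the errors telescope over
    \<open>j\<close>. Only the last block can be cut off by \<open>N\<close>.\<close>
  have h_block: "\<bar>h (j * L + r)\<bar> \<le> (1 / real j - 1 / real (j + 1)) / real L + (if j = J then 1 / real L else 0)"
    if j: "j \<ge> 1" "j \<le> J" and r: "r < L" for j r
  proof -
    have jd: "(j * L + r) div L = j" using r by simp
    show ?thesis
    proof (cases "j * L + r \<le> N")
      case True
      have jL: "0 < j * L" using j assms(2) by simp
      have "1 / real (j * L + r) \<le> 1 / real (j * L)"
        using jL by (intro frac_le) (simp_all only: of_nat_le_iff of_nat_0_less_iff le_add1 zero_le_one order.refl)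
      then have u: "1 / real (j * L + r) \<le> 1 / (real j * real L)" by (simp only: of_nat_mult)
      have "1 / real ((j + 1) * L) \<le> 1 / real (j * L + r)"
      proof (rule frac_le)
        show "0 < real (j * L + r)" using jL by (simp only: of_nat_0_less_iff trans_less_add1)
        show "real (j * L + r) \<le> real ((j + 1) * L)" using r by (simp only: of_nat_le_iff) simp
      qed simp_all
      then have l: "1 / (real (j + 1) * real L) \<le> 1 / real (j * L + r)" by (simp only: of_nat_mult)
      have "h (j * L + r) = 1 / real (j * L + r) - 1 / (real j * real L)"
        using True by (simp only: h_def jd if_True)
      then have "\<bar>h (j * L + r)\<bar> \<le> 1 / (real j * real L) - 1 / (real (j + 1) * real L)"
        using u l by (simp only: abs_le_iff) linarith
      also have "\<dots> = (1 / real j - 1 / real (j + 1)) / real L"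
        by (simp add: diff_divide_distrib)
      also have "\<dots> \<le> (1 / real j - 1 / real (j + 1)) / real L + (if j = J then 1 / real L else 0)"
        by simp
      finally show ?thesis .
    next
      case False
      have "j = J"
      proof (rule ccontr)
        assume "j \<noteq> J"
        then have "Suc j * L \<le> J * L" using j by (intro mult_le_mono1) auto
        also have "\<dots> \<le> N" by (simp add: J_def)
        finally show False using False r by simp
      qed
      have "\<bar>h (j * L + r)\<bar> = 1 / (real j * real L)"
        using False by (simp add: h_def jd)
      also have "\<dots> \<le> 1 / real L" using j assms(2) by (simp add: divide_le_cancel field_simps)
      also have "\<dots> \<le> (1 / real j - 1 / real (j + 1)) / real L + 1 / real L"
        using j by (simp add: frac_le)
      finally show ?thesis using \<open>j = J\<close> by simp
    qed
  qed
  \<comment> \<open>Block 0 is discarded altogether: the ones cost at most \<open>harm L\<close>,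
    the multiples of \<open>p\<close> at most \<open>harm (L div p)\<close>.\<close>
  have h_zero: "(\<Sum>r<L. u r * \<bar>h r\<bar>) \<le> 2 * harm L"
  proof -
    have "(\<Sum>r<L. u r * \<bar>h r\<bar>) \<le> (\<Sum>r<L. u r * (1 / real r))"
      by (intro sum_mono mult_left_mono) (auto simp: h_def u_def)
    also have "\<dots> \<le> (\<Sum>r=1..L. u r * (1 / real r))"
    proof -
      have "(\<Sum>r<L. u r * (1 / real r)) = (\<Sum>r\<in>{1..<L}. u r * (1 / real r))"
        by (rule sum.mono_neutral_right) auto
      also have "\<dots> \<le> (\<Sum>r=1..L. u r * (1 / real r))"
        by (rule sum_mono2) (auto simp: u_def)
      finally show ?thesis .
    qed
    also have "\<dots> = harm L + (\<Sum>r=1..L. if p dvd r then real p / real r else 0)"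
      unfolding harm_eq_sum sum.distrib[symmetric] by (rule sum.cong) (auto simp: u_def add_divide_distrib)
    also have "(\<Sum>r=1..L. if p dvd r then real p / real r else 0) = (\<Sum>j=1..L div p. real p / real (p * j))"
      by (rule sum_multiples[OF p])
    also have "\<dots> = harm (L div p)" using p by (simp add: harm_eq_sum)
    also have "harm (L div p) \<le> (harm L :: real)" by (rule harm_mono) simp
    finally show ?thesis by simp
  qed
  have tele: "(\<Sum>j\<in>{1..K}. 1 / real j - 1 / real (j + 1)) = 1 - 1 / real (K + 1)" for K
    by (induction K) auto
  have "(\<Sum>n=1..N. G n / real n) = (\<Sum>n<Suc J * L. G n * (if n \<le> N then 1 / real n else 0))"
  proof -
    have "(\<Sum>n=1..N. G n / real n) = (\<Sum>n=1..N. G n * (if n \<le> N then 1 / real n else 0))" by simp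
    also have "\<dots> = (\<Sum>n<Suc J * L. G n * (if n \<le> N then 1 / real n else 0))"
      by (rule sum.mono_neutral_left) (use NJ in auto)
    finally show ?thesis .
  qed
  moreover have blocks: "(\<Sum>n<Suc J * L. F n) = (\<Sum>j<Suc J. \<Sum>r<L. F (j * L + r))" for F :: "nat \<Rightarrow> real"
  proof -
    have "(\<Sum>n\<in>{j * L..<j * L + L}. F n) = (\<Sum>r<L. F (j * L + r))" for j
      using sum.shift_bounds_nat_ivl[of F 0 "j * L" L] by (simp add: atLeast0LessThan add.commute)
    then show ?thesis by (simp only: sum.nat_group[symmetric])
  qed
  moreover have "(\<Sum>j<Suc J. (\<Sum>r<L. G (j * L + r)) / (real j * real L))
      = (\<Sum>n<Suc J * L. G n * (1 / (real (n div L) * real L)))"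
    unfolding blocks sum_divide_distrib by (intro sum.cong refl) simp
  ultimately have "(\<Sum>n=1..N. G n / real n) - (\<Sum>j<Suc J. (\<Sum>r<L. G (j * L + r)) / (real j * real L))
      = (\<Sum>n<Suc J * L. G n * h n)"
    by (simp only: h_def right_diff_distrib sum_subtractf)
  also have "\<bar>\<dots>\<bar> \<le> (\<Sum>n<Suc J * L. \<bar>G n * h n\<bar>)" by (rule sum_abs)
  also have "\<dots> \<le> (\<Sum>n<Suc J * L. u n * \<bar>h n\<bar>)"
    unfolding abs_mult by (intro sum_mono mult_right_mono u) auto
  also have "\<dots> = (\<Sum>j<Suc J. \<Sum>r<L. u (j * L + r) * \<bar>h (j * L + r)\<bar>)" by (rule blocks)
  also have "\<dots> = (\<Sum>r<L. u r * \<bar>h r\<bar>) + (\<Sum>j\<in>{1..J}. \<Sum>r<L. u (j * L + r) * \<bar>h (j * L + r)\<bar>)"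
  proof -
    have "{..<Suc J} = insert 0 {1..J}" by auto
    then show ?thesis by simp
  qed
  also have "\<dots> \<le> 2 * harm L + (\<Sum>j\<in>{1..J}. 2 * (1 / real j - 1 / real (j + 1)) + (if j = J then 2 else 0))"
  proof (intro add_mono h_zero sum_mono)
    fix j assume j: "j \<in> {1..J}"
    let ?c = "(1 / real j - 1 / real (j + 1)) / real L + (if j = J then 1 / real L else 0)"
    have "(\<Sum>r<L. u (j * L + r) * \<bar>h (j * L + r)\<bar>) \<le> (\<Sum>r<L. u (j * L + r) * ?c)"
      using j by (intro sum_mono mult_left_mono h_block) (auto simp: u_def)
    also have "\<dots> = 2 * real L * ?c"
      unfolding sum_distrib_right[symmetric] u_def sum_multiples_weight_period[OF assms(1,2) p] ..
    also have "\<dots> = 2 * (1 / real j - 1 / real (j + 1)) + (if j = J then 2 else 0)"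
      using assms(2) by (simp add: distrib_left)
    finally show "(\<Sum>r<L. u (j * L + r) * \<bar>h (j * L + r)\<bar>) \<le> \<dots>" .
  qed
  also have "\<dots> \<le> 2 * harm L + 4"
  proof -
    have "(\<Sum>j\<in>{1..J}. 2 * (1 / real j - 1 / real (j + 1)) + (if j = J then 2 else 0)) \<le> 2 * (1 - 1 / real (J + 1)) + 2"
      unfolding sum.distrib sum_distrib_left[symmetric] tele by simp
    also have "\<dots> \<le> 4" by simp
    finally show ?thesis by simp
  qed
  finally show ?thesis by (simp add: J_def)
qed

section \<open>Cyclic blocks\<close>

text \<open>Shifting \<open>n\<close> by one shifts \<open>as i * n + c * bs i\<close> by \<open>as i\<close>. Recording the signs at all offsets
  \<open>q < as i\<close> makes the factor with index \<open>i\<close> readable at the single site \<open>n + c * bs i div as i\<close>,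
  at the offset \<open>q = c * bs i mod as i\<close>.\<close>
definition cyc_pattern :: "nat \<Rightarrow> nat \<Rightarrow> (nat \<Rightarrow> nat) \<Rightarrow> nat \<Rightarrow> nat \<Rightarrow> nat \<Rightarrow> (nat \<times> nat \<Rightarrow> int)" where
  "cyc_pattern k B as L j n =
    restrict (\<lambda>(i, q). liouville (as i * (j * L + n mod L) + q)) ({1..k} \<times> {..<B})"

text \<open>The correlation on block \<open>j\<close> with the end of the block glued to its
  beginning: each argument \<open>as i * n + c * bs i\<close> is split into \<open>as i\<close>
  times a site and an offset, and the site is reduced modulo \<open>L\<close>. This makes the
  function exactly periodic.\<close>

definition cyc_corr :: "nat \<Rightarrow> (nat \<Rightarrow> nat) \<Rightarrow> (nat \<Rightarrow> nat) \<Rightarrow> nat \<Rightarrow> nat \<Rightarrow> nat \<Rightarrow> nat \<Rightarrow> real" where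
  "cyc_corr k as bs L j c n =
    (\<Prod>i=1..k. of_int (liouville (as i * (j * L + (n + c * bs i div as i) mod L) + c * bs i mod as i)))"

lemma abs_cyc_corr [simp]: "\<bar>cyc_corr k as bs L j c n\<bar> = 1"
  by (simp add: cyc_corr_def)

lemma cyc_corr_mod: "cyc_corr k as bs L j c (n mod L) = cyc_corr k as bs L j c n"
  by (simp add: cyc_corr_def mod_add_left_eq)

lemma cyc_corr_eq_corr:
  assumes "\<And>i. i \<in> {1..k} \<Longrightarrow> n + c * bs i div as i < L"
  shows "cyc_corr k as bs L j c n = corr k as bs c (j * L + n)"
  unfolding cyc_corr_def corr_def
proof (rule prod.cong[OF refl])
  fix i assume "i \<in> {1..k}"
  then have "(n + c * bs i div as i) mod L = n + c * bs i div as i" using assms by simp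
  moreover have "as i * (j * L + (n + c * bs i div as i)) + c * bs i mod as i
      = as i * (j * L + n) + (as i * (c * bs i div as i) + c * bs i mod as i)"
    by (simp only: distrib_left add.assoc)
  ultimately show "real_of_int (liouville (as i * (j * L + (n + c * bs i div as i) mod L) + c * bs i mod as i))
      = of_int (liouville (as i * (j * L + n) + c * bs i))"
    by simp
qed

text \<open>All sites that are read lie inside the window; this provides the locality needed for
  \<open>sum_sieve_le_mutual_info\<close>.\<close>

lemma cyc_corr_local:
  assumes "window (cyc_pattern k B as L j) l n = window (cyc_pattern k B as L j) l n'"
    and "\<And>i. i \<in> {1..k} \<Longrightarrow> 1 \<le> as i \<and> as i \<le> B \<and> s + c * bs i div as i < l"
  shows "cyc_corr k as bs L j c (n + s) = cyc_corr k as bs L j c (n' + s)"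
  unfolding cyc_corr_def
proof (rule prod.cong[OF refl])
  fix i assume i: "i \<in> {1..k}"
  let ?d = "s + c * bs i div as i" and ?q = "c * bs i mod as i"
  have q: "?q < B" using assms(2)[OF i] by (meson mod_less_divisor less_le_trans zero_less_one)
  have "cyc_pattern k B as L j (n + ?d) = cyc_pattern k B as L j (n' + ?d)"
    using assms(1) assms(2)[OF i] by (simp add: window_eq_iff)
  from fun_cong[OF this, of "(i, ?q)"]
  show "real_of_int (liouville (as i * (j * L + (n + s + c * bs i div as i) mod L) + ?q))
      = of_int (liouville (as i * (j * L + (n' + s + c * bs i div as i) mod L) + ?q))"
    using i q by (simp add: cyc_pattern_def add.assoc)
qed

text \<open>Only the last \<open>J * q\<close> positions can wrap around. They split into
  \<open>q\<close> runs of length \<open>J\<close>, on each of which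
  \<open>\<bar>sieve p\<bar>\<close> sums to at most \<open>3 * J\<close>, and the two correlations
  differ by at most 2.\<close>

lemma cyc_corr_error:
  assumes "p dvd L" "J < p" "p \<le> 2 * J" "J * q \<le> L"
    and le: "\<And>i. i \<in> {1..k} \<Longrightarrow> c * bs i div as i \<le> J * q"
  shows "\<bar>(\<Sum>r<L. corr k as bs c (j * L + r) * sieve p (j * L + r)) - (\<Sum>r<L. cyc_corr k as bs L j c r * sieve p r)\<bar>
    \<le> 6 * real (J * q)"
proof -
  let ?D = "J * q" and ?e = "\<lambda>r. corr k as bs c (j * L + r) - cyc_corr k as bs L j c r"
  have sieve: "sieve p (j * L + r) = sieve p r" for r
    using assms(1) by (simp add: sieve_def dvd_add_right_iff)
  have "(\<Sum>r<L. corr k as bs c (j * L + r) * sieve p (j * L + r)) - (\<Sum>r<L. cyc_corr k as bs L j c r * sieve p r)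
      = (\<Sum>r<L. ?e r * sieve p r)"
    by (simp add: sieve sum_subtractf left_diff_distrib)
  also have "\<dots> = (\<Sum>r\<in>{L - ?D..<L}. ?e r * sieve p r)"
  proof (rule sum.mono_neutral_right)
    show "\<forall>r\<in>{..<L} - {L - ?D..<L}. ?e r * sieve p r = 0"
    proof
      fix r assume "r \<in> {..<L} - {L - ?D..<L}"
      then have "r + ?D < L" using assms(4) by auto
      then have "r + c * bs i div as i < L" if "i \<in> {1..k}" for i
        using le[OF that] by linarith
      then have "cyc_corr k as bs L j c r = corr k as bs c (j * L + r)" by (rule cyc_corr_eq_corr)
      then show "?e r * sieve p r = 0" by simp
    qed
  qed auto
  also have "\<bar>\<dots>\<bar> \<le> (\<Sum>r\<in>{L - ?D..<L}. 2 * \<bar>sieve p r\<bar>)"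
  proof (rule order.trans[OF sum_abs sum_mono])
    fix r
    have "\<bar>?e r\<bar> \<le> 2"
      using abs_triangle_ineq4[of "corr k as bs c (j * L + r)" "cyc_corr k as bs L j c r"] by simp
    then show "\<bar>?e r * sieve p r\<bar> \<le> 2 * \<bar>sieve p r\<bar>"
      unfolding abs_mult by (rule mult_right_mono) simp
  qed
  also have "\<dots> = 2 * (\<Sum>i<q * J. \<bar>sieve p (L - ?D + i)\<bar>)"
    using sum.shift_bounds_nat_ivl[of "\<lambda>r. \<bar>sieve p r\<bar>" 0 "L - ?D" ?D] assms(4)
    by (simp add: sum_distrib_left[symmetric] atLeast0LessThan add.commute mult.commute)
  also have "(\<Sum>i<q * J. \<bar>sieve p (L - ?D + i)\<bar>) = (\<Sum>m<q. \<Sum>i\<in>{m * J..<m * J + J}. \<bar>sieve p (L - ?D + i)\<bar>)"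
    by (rule sum.nat_group[symmetric])
  also have "\<dots> = (\<Sum>m<q. \<Sum>i<J. \<bar>sieve p (L - ?D + m * J + i)\<bar>)"
  proof (rule sum.cong[OF refl])
    fix m
    show "(\<Sum>i\<in>{m * J..<m * J + J}. \<bar>sieve p (L - ?D + i)\<bar>) = (\<Sum>i<J. \<bar>sieve p (L - ?D + m * J + i)\<bar>)"
      using sum.shift_bounds_nat_ivl[of "\<lambda>r. \<bar>sieve p (L - ?D + r)\<bar>" 0 "m * J" J]
      by (simp add: atLeast0LessThan add.commute add.left_commute)
  qed
  also have "\<dots> \<le> (\<Sum>m<q. 3 * real J)"
    by (intro sum_mono sum_abs_sieve_le assms)
  finally show ?thesis by (simp add: mult.commute)
qed

section \<open>Dyadic primes and the decrement averaged over blocks\<close>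

definition dyadic_primes :: "nat \<Rightarrow> nat set" where
  "dyadic_primes m = {p. prime p \<and> 2 ^ m < p \<and> p \<le> 2 ^ (m + 1)}"

definition dyadic_primorial :: "nat \<Rightarrow> nat" where
  "dyadic_primorial m = \<Prod>{p. prime p \<and> p \<le> 2 ^ m}"

lemma finite_dyadic_primes [simp]: "finite (dyadic_primes m)"
  by (simp add: dyadic_primes_def)

lemma dyadic_primorial_Suc: "dyadic_primorial (m + 1) = dyadic_primorial m * \<Prod>(dyadic_primes m)"
proof -
  have "{p::nat. prime p \<and> p \<le> 2 ^ (m + 1)} = {p. prime p \<and> p \<le> 2 ^ m} \<union> dyadic_primes m"
    by (auto simp: dyadic_primes_def)
  then show ?thesis
    unfolding dyadic_primorial_def by (simp only:) (rule prod.union_disjoint, auto simp: dyadic_primes_def)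
qed

lemma coprime_dyadic_primorial: "coprime (dyadic_primorial m) (\<Prod>(dyadic_primes m))"
  unfolding dyadic_primorial_def
proof (intro prod_coprime_left prod_coprime_right primes_coprime)
  fix p q :: nat
  assume "p \<in> {p. prime p \<and> p \<le> 2 ^ m}" "q \<in> dyadic_primes m"
  then show "prime p" "prime q" "p \<noteq> q" by (auto simp: dyadic_primes_def)
qed

lemma dyadic_primorial_dvd: "m \<le> n \<Longrightarrow> dyadic_primorial m dvd dyadic_primorial n"
proof (induction n rule: dec_induct)
  case (step n)
  then show ?case using dyadic_primorial_Suc[of n] by simp
qed simp

lemma dyadic_prime_dvd_primorial: "p \<in> dyadic_primes m \<Longrightarrow> p dvd dyadic_primorial (m + 1)"
  unfolding dyadic_primorial_def using dvd_prodI[of "{p. prime p \<and> p \<le> 2 ^ (m + 1)}" p id]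
  by (simp add: dyadic_primes_def)

text \<open>The entropy decrement is applied to each block, and \<open>I m\<close> is the mutual
  information at scale \<open>m\<close> averaged over the blocks. The errors come, in this order,
  from dilation and cutting into blocks, from making the blocks cyclic, and from Donsker--Varadhan,
  where \<open>t\<close> stays free for balancing.\<close>

lemma correlation_decrement:
  fixes as bs :: "nat \<Rightarrow> nat"
  assumes as: "\<And>i. i \<in> {1..k} \<Longrightarrow> 1 \<le> as i \<and> as i \<le> B"
    and bs: "\<And>i. i \<in> {1..k} \<Longrightarrow> 1 \<le> bs i \<and> bs i \<le> b"
    and "a \<ge> 1" "x > 1" "L > 0" and L: "dyadic_primorial (M + 1) dvd L" "2 * a * b * 2 ^ M \<le> L"
  obtains I :: "nat \<Rightarrow> real" where "\<And>m. I m \<ge> 0"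
    and "(\<Sum>m=1..M. I m / 2 ^ m) \<le> real (1 + 2 * a * b) * (real (k * B) * ln 2)"
    and "\<And>m t. m \<in> {1..M} \<Longrightarrow> 0 < t \<Longrightarrow> t \<le> 1 / 3 \<Longrightarrow>
      (\<Sum>p\<in>dyadic_primes m. \<bar>liouville_corr k as bs x (a * p) - (-1) ^ k * liouville_corr k as bs x a\<bar>)
        \<le> real (card (dyadic_primes m)) *
            ((7 + 3 * ln (real L)) / harm (nat \<lfloor>x\<rfloor>) + 6 * real (2 * a * b * 2 ^ m) / real L)
          + I m / t + 9 * t * real (card (dyadic_primes m))"
proof -
  define N where "N = nat \<lfloor>x\<rfloor>"
  define H where "H = (harm N :: real)"
  \<comment> \<open>A window of length \<open>l * 2 ^ m\<close> has room for a shift below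
    \<open>2 ^ m\<close> followed by a displacement \<open>a * p * bs i div as i\<close>, which is
    at most \<open>2 * a * b * 2 ^ m\<close>.\<close>
  define l where "l = 1 + 2 * a * b"
  define Z where "Z = cyc_pattern k B as L"
  \<comment> \<open>The weight of a single site. Block 0 gets weight 0; the other blocks have masses
    \<open>c j * L = 1 / j\<close>, of total \<open>harm (N div L) \<le> H\<close>.\<close>
  define c where "c j = 1 / (real j * real L)" for j
  define K where "K = {..<Suc (N div L)}"
  define mi where "mi j m = mutual_info L (Z j) (l * 2 ^ m) (dyadic_primorial m) (dyadic_primorial (m + 1))" for j m
  define I where "I m = (\<Sum>j\<in>K. c j * mi j m) / H" for m
  have N: "N \<ge> 1" using \<open>x > 1\<close> by (simp add: N_def le_nat_iff)
  then have H: "H > 0" by (simp add: H_def)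
  have c_nonneg: "c j \<ge> 0" for j by (simp add: c_def)
  have sum_c: "(\<Sum>j\<in>K. c j * real L) \<le> H"
  proof -
    have "(\<Sum>j\<in>K. c j * real L) = (\<Sum>j\<in>insert 0 {1..N div L}. 1 / real j)"
      using \<open>L > 0\<close> by (intro sum.cong) (auto simp: c_def K_def)
    also have "\<dots> = harm (N div L)" by (simp add: harm_eq_sum)
    also have "\<dots> \<le> (harm N :: real)" by (rule harm_mono) simp
    finally show ?thesis by (simp add: H_def)
  qed
  have Z_mod: "Z j (n mod L) = Z j n" for j n by (simp add: Z_def cyc_pattern_def)
  have mi_nonneg: "mi j m \<ge> 0" for j m
    unfolding mi_def by (intro mutual_info_nonneg dyadic_primorial_dvd) simp
  have "I m \<ge> 0" for m
    unfolding I_def by (intro divide_nonneg_pos sum_nonneg mult_nonneg_nonneg c_nonneg mi_nonneg H)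
  moreover have "(\<Sum>m=1..M. I m / 2 ^ m) \<le> real (1 + 2 * a * b) * (real (k * B) * ln 2)"
  proof -
    let ?S = "PiE ({1..k} \<times> {..<B}) (\<lambda>_. {-1, 1::int})"
    have "card ?S = 2 ^ (k * B)" by (subst card_PiE) (simp_all add: numeral_2_eq_2)
    then have lnS: "ln (real (card ?S)) = real (k * B) * ln 2" by (simp add: ln_realpow)
    have mi_le: "(\<Sum>m=1..M. mi j m / 2 ^ m) \<le> real L * (real l * (real (k * B) * ln 2))" for j
      unfolding mi_def lnS[symmetric]
    proof (rule sum_mutual_info_le)
      show "Z j (n mod L) = Z j n" for n by (rule Z_mod)
      show "dyadic_primorial m dvd L" if "m \<in> {1..M + 1}" for m
        using dvd_trans[OF dyadic_primorial_dvd L(1)] that by simp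
      show "range (Z j) \<subseteq> ?S"
        unfolding Z_def cyc_pattern_def using liouville_in by (intro image_subsetI) (auto simp: restrict_PiE_iff)
    qed (simp_all add: finite_PiE \<open>L > 0\<close>)
    have "(\<Sum>m=1..M. I m / 2 ^ m) = (\<Sum>m=1..M. \<Sum>j\<in>K. c j * (mi j m / 2 ^ m)) / H"
      by (simp add: I_def sum_divide_distrib mult.commute)
    also have "\<dots> = (\<Sum>j\<in>K. c j * (\<Sum>m=1..M. mi j m / 2 ^ m)) / H"
      by (subst sum.swap) (simp add: sum_distrib_left)
    also have "\<dots> \<le> (\<Sum>j\<in>K. c j * (real L * (real l * (real (k * B) * ln 2)))) / H"
      by (intro divide_right_mono sum_mono mult_left_mono mi_le c_nonneg) (use H in simp)
    also have "\<dots> = (\<Sum>j\<in>K. c j * real L) * (real l * (real (k * B) * ln 2)) / H"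
      by (simp only: sum_distrib_right mult.assoc)
    also have "\<dots> \<le> H * (real l * (real (k * B) * ln 2)) / H"
      by (intro divide_right_mono mult_right_mono sum_c) (use H in simp_all)
    also have "\<dots> = real l * (real (k * B) * ln 2)" using H by simp
    finally show ?thesis by (simp add: l_def)
  qed
  moreover have "(\<Sum>p\<in>dyadic_primes m. \<bar>liouville_corr k as bs x (a * p) - (-1) ^ k * liouville_corr k as bs x a\<bar>)
        \<le> real (card (dyadic_primes m)) *
            ((7 + 3 * ln (real L)) / harm (nat \<lfloor>x\<rfloor>) + 6 * real (2 * a * b * 2 ^ m) / real L)
          + I m / t + 9 * t * real (card (dyadic_primes m))"
    if m: "m \<in> {1..M}" and t: "0 < t" "t \<le> 1 / 3" for m t
  proof -
    let ?P = "dyadic_primes m"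
    define D where "D = 2 ^ m * (2 * a * b)"
    define y where "y p = liouville_corr k as bs x (a * p) - (-1) ^ k * liouville_corr k as bs x a" for p
    define C where "C j p r = cyc_corr k as bs L j (a * p) r" for j p r
    have "D \<le> 2 ^ M * (2 * a * b)" unfolding D_def using m by (intro mult_le_mono1 power_increasing) auto
    then have DL: "D \<le> L" using L(2) by (simp add: mult.commute)
    have P: "prime p" "2 ^ m < p" "p \<le> 2 * 2 ^ m" "p dvd L" if "p \<in> ?P" for p
    proof -
      have "dyadic_primorial (m + 1) dvd L" using m by (intro dvd_trans[OF dyadic_primorial_dvd L(1)]) simp
      then show "p dvd L" by (rule dvd_trans[OF dyadic_prime_dvd_primorial[OF that]])
    qed (use that in \<open>simp_all add: dyadic_primes_def\<close>)
    have shift_le: "a * p * bs i div as i \<le> D" if "p \<in> ?P" "i \<in> {1..k}" for p i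
    proof -
      have "a * p * bs i div as i \<le> a * p * bs i" by simp
      also have "\<dots> \<le> a * (2 * 2 ^ m) * b" using P(3)[OF that(1)] bs[OF that(2)] by (intro mult_le_mono) auto
      finally show ?thesis by (simp add: D_def mult_ac)
    qed
    \<comment> \<open>Dilation, cutting into blocks and making them cyclic are combined. The sign
      that replaces the absolute value depends on \<open>p\<close> only, so it can be absorbed into
      the functions \<open>\<psi> p\<close>. The term \<open>7 + 3 * ln L\<close> bounds
      \<open>(1 + ln p) + (2 * harm L + 4)\<close>.\<close>
    have pointwise: "H * \<bar>y p\<bar> \<le> 7 + 3 * ln (real L) + 6 * real D / real L * H
        + (\<Sum>j\<in>K. c j * (\<Sum>r<L. sgn (y p) * C j p r * sieve p r))" if p: "p \<in> ?P" for p
    proof -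
      let ?G = "\<lambda>n. corr k as bs (a * p) n * sieve p n"
      have y: "H * y p = (\<Sum>n=1..N. corr k as bs (a * p) n / real n) - (-1) ^ k * (\<Sum>n=1..N. corr k as bs a n / real n)"
        using \<open>x > 1\<close> H by (simp add: y_def liouville_corr_eq N_def[symmetric] H_def[symmetric] field_simps)
      define S1 where "S1 = (\<Sum>n=1..N. ?G n / real n)"
      define S2 where "S2 = (\<Sum>j\<in>K. (\<Sum>r<L. ?G (j * L + r)) / (real j * real L))"
      define S3 where "S3 = (\<Sum>j\<in>K. c j * (\<Sum>r<L. C j p r * sieve p r))"
      have "\<bar>H * y p - S1\<bar> \<le> 1 + ln (real p)"
        unfolding y S1_def by (rule dilation_error) (use P(1)[OF p] \<open>a \<ge> 1\<close> bs N in auto)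
      moreover have "ln (real p) \<le> ln (real L)"
        using P(1,4)[OF p] \<open>L > 0\<close> by (intro ln_mono) (auto simp: prime_gt_0_nat dvd_imp_le)
      moreover have "\<bar>S1 - S2\<bar> \<le> 2 * harm L + 4"
        unfolding S1_def S2_def K_def by (rule block_error) (use P(4)[OF p] \<open>L > 0\<close> in \<open>auto simp: abs_mult\<close>)
      moreover have "harm L \<le> 1 + ln (real L)" using \<open>L > 0\<close> by (intro harm_le_ln) simp
      moreover have "\<bar>S2 - S3\<bar> \<le> 6 * real D / real L * H"
      proof -
        have "\<bar>S2 - S3\<bar> = \<bar>\<Sum>j\<in>K. c j * ((\<Sum>r<L. ?G (j * L + r)) - (\<Sum>r<L. C j p r * sieve p r))\<bar>"
          by (simp add: S2_def S3_def sum_subtractf c_def right_diff_distrib)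
        also have "\<dots> \<le> (\<Sum>j\<in>K. c j * (6 * real D))"
        proof (rule order.trans[OF sum_abs sum_mono])
          fix j
          have "\<bar>(\<Sum>r<L. ?G (j * L + r)) - (\<Sum>r<L. C j p r * sieve p r)\<bar> \<le> 6 * real D"
            unfolding C_def D_def
            by (rule cyc_corr_error) (use P[OF p] DL shift_le[OF p] in \<open>auto simp: D_def\<close>)
          then show "\<bar>c j * ((\<Sum>r<L. ?G (j * L + r)) - (\<Sum>r<L. C j p r * sieve p r))\<bar> \<le> c j * (6 * real D)"
            using c_nonneg[of j] by (simp add: abs_mult mult_left_mono)
        qed
        also have "\<dots> = (\<Sum>j\<in>K. c j * real L) * (6 * real D / real L)"
          unfolding sum_distrib_right using \<open>L > 0\<close> by (intro sum.cong refl) simp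
        also have "\<dots> \<le> H * (6 * real D / real L)"
          by (rule mult_right_mono[OF sum_c]) simp
        finally show ?thesis by (simp only: mult.commute)
      qed
      ultimately have "\<bar>H * y p - S3\<bar> \<le> 7 + 3 * ln (real L) + 6 * real D / real L * H" by linarith
      moreover have "sgn (y p) * (H * y p - S3) \<le> \<bar>H * y p - S3\<bar>"
        by (cases "y p" "0::real" rule: linorder_cases) auto
      moreover have "sgn (y p) * (H * y p) = H * \<bar>y p\<bar>" by (simp add: sgn_if)
      moreover have "sgn (y p) * S3 = (\<Sum>j\<in>K. c j * (\<Sum>r<L. sgn (y p) * C j p r * sieve p r))"
        by (simp add: S3_def sum_distrib_left mult.left_commute mult.assoc)
      ultimately show ?thesis by (simp add: right_diff_distrib)
    qed
    have block: "(\<Sum>p\<in>?P. \<Sum>r<L. sgn (y p) * C j p r * sieve p r) \<le> mi j m / t + 9 * t * real (card ?P) * real L" for j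
    proof -
      have "t * (\<Sum>p\<in>?P. \<Sum>r<L. sgn (y p) * C j p r * sieve p r)
          \<le> mutual_info L (Z j) (l * 2 ^ m) (dyadic_primorial m) (dyadic_primorial m * \<Prod>?P) + 9 * t\<^sup>2 * real (card ?P) * real L"
      proof (rule sum_sieve_le_mutual_info)
        show "dyadic_primorial m * \<Prod>?P dvd L"
          unfolding dyadic_primorial_Suc[symmetric] using m by (intro dvd_trans[OF dyadic_primorial_dvd L(1)]) simp
        show "prime p \<and> 2 ^ m < p \<and> p \<le> 2 * 2 ^ m" if "p \<in> ?P" for p using P[OF that] by simp
        show "\<bar>sgn (y p) * C j p n\<bar> \<le> 1" for p n by (simp add: C_def abs_mult abs_sgn_eq)
        show "sgn (y p) * C j p (n + i) = sgn (y p) * C j p (n' + i)"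
          if "p \<in> ?P" "i < 2 ^ m" "window (Z j) (l * 2 ^ m) n = window (Z j) (l * 2 ^ m) n'" for p n n' i
        proof -
          have "l * 2 ^ m = 2 ^ m + D" by (simp add: l_def D_def algebra_simps)
          then have "1 \<le> as u \<and> as u \<le> B \<and> i + a * p * bs u div as u < l * 2 ^ m" if "u \<in> {1..k}" for u
            using as[OF that] shift_le[OF \<open>p \<in> ?P\<close> that] \<open>i < 2 ^ m\<close> by linarith
          then have "C j p (n + i) = C j p (n' + i)"
            unfolding C_def by (rule cyc_corr_local[OF that(3)[unfolded Z_def]])
          then show ?thesis by simp
        qed
      qed (use t \<open>L > 0\<close> coprime_dyadic_primorial Z_mod in \<open>simp_all add: C_def cyc_corr_mod\<close>)
      then have "t * (\<Sum>p\<in>?P. \<Sum>r<L. sgn (y p) * C j p r * sieve p r) \<le> t * (mi j m / t + 9 * t * real (card ?P) * real L)"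
        using t by (simp add: mi_def dyadic_primorial_Suc[symmetric, simplified] power2_eq_square distrib_left mult.assoc)
      then show ?thesis using t by simp
    qed
    have "H * (\<Sum>p\<in>?P. \<bar>y p\<bar>) = (\<Sum>p\<in>?P. H * \<bar>y p\<bar>)" by (rule sum_distrib_left)
    also have "\<dots> \<le> (\<Sum>p\<in>?P. 7 + 3 * ln (real L) + 6 * real D / real L * H
        + (\<Sum>j\<in>K. c j * (\<Sum>r<L. sgn (y p) * C j p r * sieve p r)))"
      by (rule sum_mono) (rule pointwise)
    also have "\<dots> = real (card ?P) * (7 + 3 * ln (real L) + 6 * real D / real L * H)
        + (\<Sum>j\<in>K. c j * (\<Sum>p\<in>?P. \<Sum>r<L. sgn (y p) * C j p r * sieve p r))"
    proof -
      have "(\<Sum>p\<in>?P. \<Sum>j\<in>K. c j * (\<Sum>r<L. sgn (y p) * C j p r * sieve p r))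
          = (\<Sum>j\<in>K. c j * (\<Sum>p\<in>?P. \<Sum>r<L. sgn (y p) * C j p r * sieve p r))"
        by (subst sum.swap) (simp only: sum_distrib_left)
      then show ?thesis by (simp only: sum.distrib[of _ _ ?P] sum_constant)
    qed
    also have "(\<Sum>j\<in>K. c j * (\<Sum>p\<in>?P. \<Sum>r<L. sgn (y p) * C j p r * sieve p r))
        \<le> (\<Sum>j\<in>K. c j * (mi j m / t + 9 * t * real (card ?P) * real L))"
      by (intro sum_mono mult_left_mono block c_nonneg)
    also have "\<dots> = (\<Sum>j\<in>K. c j * mi j m) / t + 9 * t * real (card ?P) * (\<Sum>j\<in>K. c j * real L)"
      by (simp add: distrib_left sum.distrib sum_divide_distrib sum_distrib_left mult_ac)
    also have "\<dots> \<le> H * I m / t + 9 * t * real (card ?P) * H"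
      using t sum_c H by (intro add_mono mult_left_mono) (simp_all add: I_def)
    finally have "H * (\<Sum>p\<in>?P. \<bar>y p\<bar>) \<le>
        H * (real (card ?P) * ((7 + 3 * ln (real L)) / H + 6 * real D / real L) + I m / t + 9 * t * real (card ?P))"
      using H by (simp add: distrib_left add_divide_distrib mult_ac)
    then show ?thesis
      using H by (simp add: y_def D_def H_def N_def mult_ac)
  qed
  ultimately show thesis by (rule that)
qed

section \<open>Choice of parameters\<close>

lemma ln_dyadic_primorial_le: "ln (real (dyadic_primorial m)) \<le> 2 ^ m * ln 4"
proof -
  have pos: "dyadic_primorial m > 0"
    unfolding dyadic_primorial_def by (rule prod_pos) (auto simp: prime_gt_0_nat)
  have "real (dyadic_primorial m) \<le> real (4 ^ (2 ^ m))"
    using primorial_le[of "2 ^ m"] unfolding dyadic_primorial_def by (simp only: of_nat_le_iff)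
  then have "ln (real (dyadic_primorial m)) \<le> ln (real (4 ^ (2 ^ m)))"
    using pos by (intro ln_mono) simp_all
  also have "\<dots> = 2 ^ m * ln 4" by (simp add: ln_realpow)
  finally show ?thesis .
qed

text \<open>Logarithms are taken and \<open>ln (1 / \<epsilon>) \<le> 1 / \<epsilon>\<close> is
  used. This confines the scales with an error above \<open>\<epsilon>\<close> to an initial segment
  of length of order \<open>1 / \<epsilon>\<close>.\<close>

lemma ln_bound_pow:
  assumes "0 < \<epsilon>" "\<epsilon> < (2 / exp 1) ^ m"
  shows "real m \<le> 1 / (1 - ln 2) * (1 / \<epsilon>)"
proof -
  have "ln \<epsilon> < ln ((2 / exp 1) ^ m)" using assms by (simp add: ln_less_cancel_iff[THEN iffD2])
  also have "\<dots> = real m * (ln 2 - 1)" by (simp add: ln_realpow ln_div)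
  finally have "real m * (1 - ln 2) < ln (1 / \<epsilon>)" using assms by (simp add: ln_div algebra_simps)
  also have "\<dots> \<le> 1 / \<epsilon>" using assms ln_le_minus_one[of "1 / \<epsilon>"] by simp
  finally have "real m * (1 - ln 2) \<le> 1 / \<epsilon>" by simp
  moreover have "1 - ln (2::real) > 0" using ln_2_less_1 by simp
  ultimately have "real m \<le> (1 / \<epsilon>) / (1 - ln 2)" by (simp only: pos_le_divide_eq)
  then show ?thesis by (simp add: mult.commute)
qed

lemma sum_inverse_le_card:
  assumes "A \<subseteq> {1..n::nat}"
  shows "(\<Sum>m\<in>A. 1 / real m) \<le> real n"
proof -
  have "(\<Sum>m\<in>A. 1 / real m) \<le> (\<Sum>m\<in>{1..n}. 1)"
  proof (rule order.trans[OF sum_mono2])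
    show "(\<Sum>m=1..n. 1 / real m) \<le> (\<Sum>m=1..n. 1)" by (rule sum_mono) auto
  qed (use assms in auto)
  then show ?thesis by simp
qed

text \<open>\<open>ln L\<close> is of order \<open>2 ^ M0\<close>, whereas
  \<open>harm (nat \<lfloor>x\<rfloor>)\<close> is at least \<open>ln x \<ge> exp M0\<close>. The
  factor \<open>8 ^ M0\<close> in \<open>L\<close> exceeds \<open>a * 2 ^ m < 4 ^ M0\<close> by at
  least \<open>2 ^ M0\<close>, which controls the loss at the ends of the blocks.\<close>

lemma scale_error:
  fixes a b M0 m :: nat and x :: real
  defines "L \<equiv> dyadic_primorial (M0 + 1) * (2 * b * 8 ^ M0)"
  assumes "a < 2 ^ M0" "b \<ge> 1" "real M0 \<le> ln (ln x)" "x > 1" "m \<le> M0"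
  shows "(7 + 3 * ln (real L)) / harm (nat \<lfloor>x\<rfloor>) + 6 * real (2 * a * b * 2 ^ m) / real L
    \<le> (13 + 6 * ln 4 + 3 * ln (real (2 * b)) + 3 * ln 8) * (2 / exp 1) ^ m"
proof -
  let ?R = "dyadic_primorial (M0 + 1)" and ?C = "7 + 6 * ln 4 + 3 * ln (real (2 * b)) + 3 * ln 8"
  have R: "?R > 0" unfolding dyadic_primorial_def by (rule prod_pos) (auto simp: prime_gt_0_nat)
  have lnb: "ln (real (2 * b)) \<ge> 0" using assms by simp
  have C: "?C \<ge> 0" using lnb by (intro add_nonneg_nonneg) simp_all
  have two: "(1::real) \<le> 2 ^ M0" "real M0 \<le> 2 ^ M0" using of_nat_less_two_power[of M0, where 'a = real] by simp_all
  have e2: "2 / exp 1 \<le> (1::real)" "1 / 2 \<le> 2 / exp (1::real)" using exp_le exp_ge_add_one_self[of 1] by (auto simp: field_simps)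
  have "ln (real L) = ln (real ?R) + (ln (real (2 * b)) + real M0 * ln 8)"
    unfolding L_def of_nat_mult of_nat_power of_nat_numeral using R assms by (simp add: ln_mult ln_realpow)
  also have "\<dots> \<le> 2 ^ (M0 + 1) * ln 4 + (2 ^ M0 * ln (real (2 * b)) + 2 ^ M0 * ln 8)"
    using lnb two mult_right_mono[OF two(1) lnb] mult_right_mono[OF two(2), of "ln 8"]
    by (intro add_mono ln_dyadic_primorial_le) auto
  finally have lnL: "ln (real L) \<le> 2 ^ (M0 + 1) * ln 4 + (2 ^ M0 * ln (real (2 * b)) + 2 ^ M0 * ln 8)" .
  have "7 + 3 * ln (real L) \<le> 7 * 2 ^ M0 + 3 * (2 ^ (M0 + 1) * ln 4 + (2 ^ M0 * ln (real (2 * b)) + 2 ^ M0 * ln 8))"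
    using two by (intro add_mono mult_left_mono lnL) simp_all
  then have num: "7 + 3 * ln (real L) \<le> ?C * 2 ^ M0" by (simp add: algebra_simps)
  have "exp (real M0) \<le> exp (ln (ln x))" using assms(4) by (simp only: exp_le_cancel_iff)
  also have "\<dots> = ln x" using \<open>x > 1\<close> by simp
  also have "\<dots> \<le> ln (real (nat \<lfloor>x\<rfloor>) + 1)" using \<open>x > 1\<close> by (intro ln_mono) linarith+
  also have "\<dots> \<le> harm (nat \<lfloor>x\<rfloor>)" by (rule harm_ge_ln)
  finally have H: "exp (real M0) \<le> harm (nat \<lfloor>x\<rfloor>)" .
  have "(7 + 3 * ln (real L)) / harm (nat \<lfloor>x\<rfloor>) \<le> ?C * 2 ^ M0 / exp (real M0)"
    by (rule frac_le) (use num H C in \<open>auto intro!: mult_nonneg_nonneg\<close>)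
  also have "\<dots> = ?C * (2 / exp 1) ^ M0"
    by (simp add: power_divide exp_of_nat_mult[symmetric])
  also have "\<dots> \<le> ?C * (2 / exp 1) ^ m"
    by (intro mult_left_mono power_decreasing e2 C \<open>m \<le> M0\<close>) simp
  finally have 1: "(7 + 3 * ln (real L)) / harm (nat \<lfloor>x\<rfloor>) \<le> ?C * (2 / exp 1) ^ m" .
  have "real (2 * a * b * 2 ^ m) / real L \<le> (1 / 2) ^ M0"
  proof -
    have "2 * a * b * 2 ^ m \<le> 2 * 2 ^ M0 * b * 2 ^ M0"
      using assms by (intro mult_le_mono power_increasing) auto
    then have "2 * a * b * 2 ^ m * 2 ^ M0 \<le> 2 * 2 ^ M0 * b * 2 ^ M0 * 2 ^ M0" by (rule mult_le_mono1)
    also have "\<dots> = 2 * b * 8 ^ M0" by (simp add: power_mult_distrib[symmetric] mult.commute mult.left_commute)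
    also have "\<dots> \<le> L" unfolding L_def using R by simp
    finally have "real (2 * a * b * 2 ^ m * 2 ^ M0) \<le> real L" by (simp only: of_nat_le_iff)
    moreover have "L > 0" using R assms by (simp add: L_def)
    ultimately show ?thesis by (simp add: power_divide field_simps)
  qed
  also have "\<dots> \<le> (1 / 2) ^ m" using \<open>m \<le> M0\<close> by (intro power_decreasing) auto
  also have "\<dots> \<le> (2 / exp 1) ^ m" by (intro power_mono e2) simp
  finally have 2: "6 * real (2 * a * b * 2 ^ m) / real L \<le> 6 * (2 / exp 1) ^ m" by simp
  show ?thesis using add_mono[OF 1 2] by (simp add: algebra_simps)
qed

theorem theorem3p1:
  fixes k :: nat and as bs :: "nat \<Rightarrow> nat"
  assumes "k \<ge> 1"
    and "\<And>i. i \<in> {1..k} \<Longrightarrow> as i \<ge> 1"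
    and "\<And>i. i \<in> {1..k} \<Longrightarrow> bs i \<ge> 1"
  shows "\<exists>C::real. C > 0 \<and>
    (\<forall>(\<epsilon>::real) (x::real) (a::nat). 0 < \<epsilon> \<and> \<epsilon> < 1 \<and> x > 1 \<and> a \<ge> 1 \<longrightarrow>
      (\<exists>M::nat set. M \<subseteq> {1..} \<and>
         (\<lambda>m. 1 / real m) summable_on M \<and>
         (\<Sum>\<^sub>\<infinity>m\<in>M. 1 / real m) \<le> C * real a * \<epsilon> powi (-3) \<and>
         (\<forall>m::nat. m \<ge> 1 \<and> real m \<le> ln (ln x) \<and> m \<notin> M \<longrightarrow>
            avg {p. prime p \<and> 2 ^ m < p \<and> p \<le> 2 ^ (m + 1)}
              (\<lambda>p. \<bar>liouville_corr k as bs x (a * p) - (-1) ^ k * liouville_corr k as bs x a\<bar>)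
              \<le> C * \<epsilon>)))"
proof -
  obtain m0 where m0: "\<And>m. m \<ge> m0 \<Longrightarrow> 2 ^ m / (4 * real m) \<le> real (card (dyadic_primes m))"
    using card_dyadic_primes_ge unfolding dyadic_primes_def by blast
  define b where "b = (\<Sum>i=1..k. bs i) + 1"
  define B where "B = (\<Sum>i=1..k. as i)"
  define c0 where "c0 = 1 / (1 - ln (2::real))"
  define E where "E = 13 + 6 * ln 4 + 3 * ln (real (2 * b)) + 3 * ln (8::real)"
  define S where "S = real (k * B) * ln 2"
  \<comment> \<open>The terms \<open>m0\<close>, \<open>c0\<close> and
    \<open>4 * (1 + 2 * b) * S\<close> pay for the three kinds of exceptional scales, and
    \<open>E + 6\<close> for the bound at the other scales.\<close>
  define C where "C = 1 + real m0 + c0 + 4 * (1 + 2 * real b) * S + E + 6"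
  have as: "1 \<le> as i \<and> as i \<le> B" if "i \<in> {1..k}" for i
    using assms(2)[OF that] member_le_sum[OF that, of as] by (simp add: B_def)
  have bs: "1 \<le> bs i \<and> bs i \<le> b" if "i \<in> {1..k}" for i
    using assms(3)[OF that] member_le_sum[OF that, of bs] by (simp add: b_def)
  have b: "b \<ge> 1" by (simp add: b_def)
  have c0: "c0 > 0" using ln_2_less_1 by (simp add: c0_def)
  have S: "S \<ge> 0" by (simp add: S_def)
  have E: "E \<ge> 0" unfolding E_def using b by (intro add_nonneg_nonneg) simp_all
  have S': "4 * (1 + 2 * real b) * S \<ge> 0" using S by simp
  have C: "C \<ge> 1" "C \<ge> E + 6" "C \<ge> real m0 + c0 + 4 * (1 + 2 * real b) * S"
    using c0 S' E by (simp_all add: C_def)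
  show ?thesis
  proof (intro exI[of _ C] conjI allI impI)
    show "C > 0" using C by simp
    fix \<epsilon> x :: real and a :: nat
    assume "0 < \<epsilon> \<and> \<epsilon> < 1 \<and> x > 1 \<and> a \<ge> 1"
    then have eps: "0 < \<epsilon>" "\<epsilon> < 1" and x: "x > 1" and a: "a \<ge> 1" by auto
    define T where "T = \<epsilon> powi (-3)"
    have T_eq: "T = 1 / \<epsilon> ^ 3" by (simp add: T_def power_int_minus inverse_eq_divide)
    have T: "T \<ge> 1" "T \<ge> 1 / \<epsilon>" "T \<ge> 1 / \<epsilon>\<^sup>2"
      unfolding T_eq using eps power_decreasing[of 1 3 \<epsilon>] power_decreasing[of 2 3 \<epsilon>] power_le_one[of \<epsilon> 3]
      by (simp_all add: divide_left_mono)
    have aT: "real a * T \<ge> T" using a T by simp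
    have aT1: "real a * T \<ge> 1" using T(1) aT by (rule order.trans)
    define M0 where "M0 = nat \<lfloor>ln (ln x)\<rfloor>"
    have M0: "m \<in> {1..M0}" if "m \<ge> 1" "real m \<le> ln (ln x)" for m
      using that le_nat_floor by (simp add: M0_def)
    let ?f = "\<lambda>p. \<bar>liouville_corr k as bs x (a * p) - (-1) ^ k * liouville_corr k as bs x a\<bar>"
    have "\<exists>X\<subseteq>{1..M0}. (\<Sum>m\<in>X. 1 / real m) \<le> C * real a * T \<and>
      (\<forall>m\<in>{1..M0} - X. avg (dyadic_primes m) ?f \<le> C * \<epsilon>)"
      \<comment> \<open>For \<open>a \<ge> 2 ^ M0\<close> the admitted size of the exceptional set covers all scales; otherwise \<open>ln a\<close> is
        negligible against \<open>ln x\<close>.\<close>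
    proof (cases "2 ^ M0 \<le> a")
      case True
      have "(\<Sum>m\<in>{1..M0}. 1 / real m) \<le> real M0" by (rule sum_inverse_le_card) simp
      also have "\<dots> \<le> 2 ^ M0" using of_nat_less_two_power[of M0, where 'a = real] by simp
      also have "\<dots> \<le> real a" using True by (metis of_nat_le_iff of_nat_numeral of_nat_power)
      also have "\<dots> \<le> C * real a * T"
        using mult_mono[of 1 C 1 T] C T a by (simp add: mult_ac mult_left_le)
      finally show ?thesis by (intro exI[of _ "{1..M0}"]) auto
    next
      case False
      \<comment> \<open>\<open>nat\<close> turns a negative \<open>ln (ln x)\<close> into 0; as
        \<open>1 \<le> a < 2 ^ M0\<close> excludes \<open>M0 = 0\<close>, \<open>M0\<close> is a
        true floor.\<close>
      then have "M0 \<noteq> 0" using a by (intro notI) simp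
      then have M0_le: "real M0 \<le> ln (ln x)" by (simp add: M0_def)
      define L where "L = dyadic_primorial (M0 + 1) * (2 * b * 8 ^ M0)"
      have R: "dyadic_primorial (M0 + 1) > 0"
        unfolding dyadic_primorial_def by (rule prod_pos) (auto simp: prime_gt_0_nat)
      have "2 * a * b * 2 ^ M0 \<le> 2 * 2 ^ M0 * b * 4 ^ M0"
        using False by (intro mult_le_mono power_mono) auto
      also have "\<dots> = 2 * b * 8 ^ M0" by (simp add: power_mult_distrib[symmetric] mult.commute mult.left_commute)
      also have "\<dots> \<le> L" unfolding L_def using R by simp
      finally have DL: "2 * a * b * 2 ^ M0 \<le> L" .
      have L: "L > 0" "dyadic_primorial (M0 + 1) dvd L" using R b by (simp_all add: L_def)
      obtain I where I: "\<And>m. I m \<ge> 0" "(\<Sum>m=1..M0. I m / 2 ^ m) \<le> real (1 + 2 * a * b) * S"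
        and dec: "\<And>m t. m \<in> {1..M0} \<Longrightarrow> 0 < t \<Longrightarrow> t \<le> 1 / 3 \<Longrightarrow> (\<Sum>p\<in>dyadic_primes m. ?f p)
          \<le> real (card (dyadic_primes m)) * ((7 + 3 * ln (real L)) / harm (nat \<lfloor>x\<rfloor>) + 6 * real (2 * a * b * 2 ^ m) / real L)
            + I m / t + 9 * t * real (card (dyadic_primes m))"
        by (rule correlation_decrement[of k as B bs b a x L M0, OF as bs a x L DL, folded S_def]) (assumption+, rule that)
      \<comment> \<open>Exceptional are the scales below the range of the lower bound for the number
        of primes, those where the error \<open>(2 / exp 1) ^ m\<close> exceeds
        \<open>\<epsilon>\<close>, and those with large mutual information per prime.\<close>
      define A1 where "A1 = {m\<in>{1..M0}. m < m0}"
      define A2 where "A2 = {m\<in>{1..M0}. \<epsilon> < (2 / exp 1) ^ m}"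
      define A3 where "A3 = {m\<in>{1..M0}. m0 \<le> m \<and> \<epsilon>\<^sup>2 * real (card (dyadic_primes m)) < I m}"
      have sum1: "(\<Sum>m\<in>A1. 1 / real m) \<le> real m0"
        by (rule sum_inverse_le_card) (auto simp: A1_def)
      have sum2: "(\<Sum>m\<in>A2. 1 / real m) \<le> c0 * T"
      proof -
        have "(\<Sum>m\<in>A2. 1 / real m) \<le> real (nat \<lfloor>c0 * (1 / \<epsilon>)\<rfloor>)"
        proof (rule sum_inverse_le_card, rule subsetI)
          fix m assume m: "m \<in> A2"
          then have "real m \<le> c0 * (1 / \<epsilon>)"
            unfolding c0_def by (intro ln_bound_pow eps) (simp add: A2_def)
          then have "m \<le> nat \<lfloor>c0 * (1 / \<epsilon>)\<rfloor>" by (rule le_nat_floor)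
          then show "m \<in> {1..nat \<lfloor>c0 * (1 / \<epsilon>)\<rfloor>}" using m by (simp add: A2_def)
        qed
        also have "\<dots> \<le> c0 * (1 / \<epsilon>)" using c0 eps by (intro of_nat_floor) simp
        also have "\<dots> \<le> c0 * T" using c0 T by (intro mult_left_mono) auto
        finally show ?thesis .
      qed
      have sum3: "(\<Sum>m\<in>A3. 1 / real m) \<le> 4 * (1 + 2 * real b) * S * (real a * T)"
      proof -
        \<comment> \<open>The lower bound for the number of primes gives
          \<open>I m \<ge> \<epsilon>\<^sup>2 * 2 ^ m / (4 * m)\<close> on \<open>A3\<close>, so
          \<open>1 / m\<close> is controlled by a summand of the entropy decrement.\<close>
        have "(\<Sum>m\<in>A3. 1 / real m) \<le> (\<Sum>m\<in>A3. 4 / \<epsilon>\<^sup>2 * (I m / 2 ^ m))"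
        proof (rule sum_mono)
          fix m assume m: "m \<in> A3"
          then have "m \<ge> 1" "m0 \<le> m" by (auto simp: A3_def)
          have "\<epsilon>\<^sup>2 * (2 ^ m / (4 * real m)) \<le> \<epsilon>\<^sup>2 * real (card (dyadic_primes m))"
            using m0[OF \<open>m0 \<le> m\<close>] by (intro mult_left_mono) simp_all
          also have "\<dots> \<le> I m" using m by (simp add: A3_def)
          finally have "\<epsilon>\<^sup>2 * (2 ^ m / (4 * real m)) \<le> I m" .
          then have "4 / (\<epsilon>\<^sup>2 * 2 ^ m) * (\<epsilon>\<^sup>2 * (2 ^ m / (4 * real m))) \<le> 4 / (\<epsilon>\<^sup>2 * 2 ^ m) * I m"
            using eps by (intro mult_left_mono) simp_all
          then show "1 / real m \<le> 4 / \<epsilon>\<^sup>2 * (I m / 2 ^ m)" using eps by simp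
        qed
        also have "\<dots> = 4 * (1 / \<epsilon>\<^sup>2) * (\<Sum>m\<in>A3. I m / 2 ^ m)" by (simp add: sum_distrib_left)
        also have "\<dots> \<le> 4 * T * (real (1 + 2 * a * b) * S)"
        proof (rule mult_mono)
          have "(\<Sum>m\<in>A3. I m / 2 ^ m) \<le> (\<Sum>m=1..M0. I m / 2 ^ m)"
            using I(1) by (intro sum_mono2) (auto simp: A3_def)
          then show "(\<Sum>m\<in>A3. I m / 2 ^ m) \<le> real (1 + 2 * a * b) * S" using I(2) by linarith
        qed (use T I(1) in \<open>auto intro!: sum_nonneg\<close>)
        \<comment> \<open>The window length factor \<open>1 + 2 * a * b\<close> is what brings
          \<open>a\<close> into the bound for the exceptional set.\<close>
        also have "\<dots> \<le> 4 * T * ((real a * (1 + 2 * real b)) * S)"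
          using a S T by (intro mult_left_mono mult_right_mono) (simp_all add: algebra_simps)
        finally show ?thesis by (simp add: mult_ac)
      qed
      show ?thesis
      proof (intro exI[of _ "A1 \<union> A2 \<union> A3"] conjI ballI)
        show "A1 \<union> A2 \<union> A3 \<subseteq> {1..M0}" by (auto simp: A1_def A2_def A3_def)
        have fin: "finite A1" "finite A2" "finite A3" by (simp_all add: A1_def A2_def A3_def)
        have "(\<Sum>m\<in>X \<union> Y. 1 / real m) \<le> (\<Sum>m\<in>X. 1 / real m) + (\<Sum>m\<in>Y. 1 / real m)"
          if "finite X" "finite Y" for X Y
          using that sum_nonneg[of "X \<inter> Y" "\<lambda>m. 1 / real m"] by (simp add: sum_Un)
        then have "(\<Sum>m\<in>A1 \<union> A2 \<union> A3. 1 / real m)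
            \<le> (\<Sum>m\<in>A1. 1 / real m) + (\<Sum>m\<in>A2. 1 / real m) + (\<Sum>m\<in>A3. 1 / real m)"
          using fin by (smt (verit) finite_Un)
        also have "\<dots> \<le> real m0 * (real a * T) + c0 * (real a * T) + 4 * (1 + 2 * real b) * S * (real a * T)"
        proof (intro add_mono sum3)
          have "real m0 * 1 \<le> real m0 * (real a * T)" by (rule mult_left_mono[OF aT1]) simp
          then show "(\<Sum>m\<in>A1. 1 / real m) \<le> real m0 * (real a * T)" using sum1 by linarith
          have "c0 * T \<le> c0 * (real a * T)" using c0 by (intro mult_left_mono[OF aT]) simp
          then show "(\<Sum>m\<in>A2. 1 / real m) \<le> c0 * (real a * T)" using sum2 by linarith
        qed
        also have "\<dots> = (real m0 + c0 + 4 * (1 + 2 * real b) * S) * (real a * T)" by (simp only: distrib_right)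
        also have "\<dots> \<le> C * (real a * T)" by (rule mult_right_mono[OF C(3)]) (use aT1 in linarith)
        finally show "(\<Sum>m\<in>A1 \<union> A2 \<union> A3. 1 / real m) \<le> C * real a * T" by (simp only: mult.assoc)
      next
        fix m assume m: "m \<in> {1..M0} - (A1 \<union> A2 \<union> A3)"
        let ?N = "real (card (dyadic_primes m))"
        have m1: "m \<in> {1..M0}" "m \<ge> m0" "(2 / exp 1) ^ m \<le> \<epsilon>" "I m \<le> \<epsilon>\<^sup>2 * ?N"
          using m by (auto simp: A1_def A2_def A3_def)
        have "0 < 2 ^ m / (4 * real m)" using m1 by simp
        then have N: "?N > 0" using m0[OF m1(2)] by linarith
        \<comment> \<open>The choice \<open>t = \<epsilon> / 3\<close> balances the last two terms:
          with \<open>I m \<le> \<epsilon>\<^sup>2 * ?N\<close> both are at most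
          \<open>3 * \<epsilon> * ?N\<close>.\<close>
        have "(\<Sum>p\<in>dyadic_primes m. ?f p)
          \<le> ?N * ((7 + 3 * ln (real L)) / harm (nat \<lfloor>x\<rfloor>) + 6 * real (2 * a * b * 2 ^ m) / real L)
            + I m / (\<epsilon> / 3) + 9 * (\<epsilon> / 3) * ?N"
          by (rule dec[OF m1(1)]) (use eps in auto)
        also have "\<dots> \<le> ?N * (E * \<epsilon>) + 3 * \<epsilon> * ?N + 3 * \<epsilon> * ?N"
        proof (intro add_mono mult_left_mono)
          have "(7 + 3 * ln (real L)) / harm (nat \<lfloor>x\<rfloor>) + 6 * real (2 * a * b * 2 ^ m) / real L \<le> E * (2 / exp 1) ^ m"
            unfolding E_def L_def by (rule scale_error) (use False b M0_le x m1 in auto)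
          also have "\<dots> \<le> E * \<epsilon>" using m1 E by (intro mult_left_mono) auto
          finally show "(7 + 3 * ln (real L)) / harm (nat \<lfloor>x\<rfloor>) + 6 * real (2 * a * b * 2 ^ m) / real L \<le> E * \<epsilon>" .
          have "I m / (\<epsilon> / 3) \<le> \<epsilon>\<^sup>2 * ?N / (\<epsilon> / 3)" using m1 eps by (intro divide_right_mono) auto
          then show "I m / (\<epsilon> / 3) \<le> 3 * \<epsilon> * ?N" using eps by (simp add: power2_eq_square)
        qed auto
        also have "\<dots> = ((E + 6) * \<epsilon>) * ?N" by (simp add: algebra_simps)
        finally have "avg (dyadic_primes m) ?f \<le> (E + 6) * \<epsilon>" using N by (simp add: avg_def pos_divide_le_eq)
        also have "\<dots> \<le> C * \<epsilon>" using C eps by (intro mult_right_mono) auto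
        finally show "avg (dyadic_primes m) ?f \<le> C * \<epsilon>" .
      qed
    qed
    then obtain X where X: "X \<subseteq> {1..M0}" "(\<Sum>m\<in>X. 1 / real m) \<le> C * real a * T"
      "\<And>m. m \<in> {1..M0} - X \<Longrightarrow> avg (dyadic_primes m) ?f \<le> C * \<epsilon>" by blast
    have "finite X" using X(1) by (rule finite_subset) simp
    then show "\<exists>M::nat set. M \<subseteq> {1..} \<and>
         (\<lambda>m. 1 / real m) summable_on M \<and>
         (\<Sum>\<^sub>\<infinity>m\<in>M. 1 / real m) \<le> C * real a * \<epsilon> powi (-3) \<and>
         (\<forall>m::nat. m \<ge> 1 \<and> real m \<le> ln (ln x) \<and> m \<notin> M \<longrightarrow>
            avg {p. prime p \<and> 2 ^ m < p \<and> p \<le> 2 ^ (m + 1)} ?f \<le> C * \<epsilon>)"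
      using X M0 unfolding T_def dyadic_primes_def by (intro exI[of _ X]) (auto simp: subset_iff)
  qed
qed

end
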